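(* Let $\Gamma$ be a ribbon graph of a connected trivalent graph $G(V,E)$ that contains a pentagonal face whose five emanating edges (spokes) $s_1,\dots,s_5$, listed in clockwise order around the face, are pairwise distinct edges of $\Gamma$. Let $\Gamma_P=\Gamma$, and let $\Gamma_Q$ and $\Gamma_{T_m}$ ($m\in\{1,2,3,4,5\}$) be the ribbon graphs obtained from $\Gamma$ by replacing the pentagon by, respectively, the following planar trivalent configurations on the same five spoke ends (all internal edges untwisted, spoke indices mod 5): - $Q$: a quadrilateral face whose four emanating edges in clockwise order are $s_1,s_2,s_3,f$, where the edge $f$ ends at a further trivalent vertex with clockwise order $(s_4,s_5,f)$; - $T_m$: the tree with three trivalent vertices and two internal edges $f,g$, whose vertices have clockwise orders $(s_m,f,g)$, $(s_{m+1},s_{m+2},f)$ and $(s_{m+3},s_{m+4},g)$. Then the Penrose polynomials evaluated at $n=4$ satisfy $$[\Gamma_P]_4=\tfrac32[\Gamma_Q]_4-4[\Gamma_{T_2}]_4-[\Gamma_{T_3}]_4+2[\Gamma_{T_4}]_4+2[\Gamma_{T_5}]_4-[\Gamma_{T_1}]_4 .$$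
   Context: Ribbon graphs. A ribbon graph $\Gamma$ of a finite graph $G(V,E)$ (loops and multiple edges allowed) is a compact surface with boundary made of a disc for each vertex and a ribbon (band) for each edge, attached to the vertex discs; capping its boundary circles (faces) with discs gives a closed surface. It is presented by a cyclic order of half-edges at each vertex together with a label "untwisted" or "half-twisted" on each edge. Penrose polynomial. For a trivalent graph with a perfect matching $M$, the bracket $[\Gamma_M]_n$ of the perfect matching graph $\Gamma_M$ is computed by replacing each matching edge by the difference (0-smoothing) $-$ (1-smoothing): the 0-smoothing deletes the edge and joins the four remaining strands along the two sides of its ribbon; the 1-smoothing joins them along the two sides of the ribbon after inserting an extra half-twist (so the two strands cross). A closed circle has value $n$ (multiplicatively). For an arbitrary ribbon graph $\Gamma$, the blowup $\Gamma_E^\flat$ replaces each vertex of degree $d$ by a $d$-cycle (the boundary of the vertex disc), with canonical perfect matching the original edge set $E$, and $[\Gamma]_n:=[\Gamma_E^\flat]_n$. Explicitly, $[\Gamma]_n=\sum_{A\subseteq E}(-1)^{|A|}n^{b(A)}$, where $b(A)$ is the number of boundary circles of the ribbon surface obtained from $\Gamma$ by inserting an extra half-twist in the ribbon of each edge of $A$. The graphs need not be connected or trivalent for this definition. Polygonal faces and replacement. A $k$-gonal face with emanating edges $t_1,\dots,t_k$ in clockwise order means: trivalent vertices $v_1,\dots,v_k$ (indices mod $k$), untwisted edges $c_i$ from $v_i$ to $v_{i+1}$, and emanating edges $t_i$ at $v_i$, with clockwise order $(t_i,c_i,c_{i-1})$ at $v_i$, so that the cycle $c_1\cdots c_k$ bounds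 a face disc. The pentagon (its vertices and the edges $c_i$) lies in a disc whose boundary meets the spokes at five points in clockwise order $s_1,\dots,s_5$. Replacing the configuration changes only the inside of this disc. *)

theory Defs
  imports
    "Graph_Theory.Graph_Theory"
    "HOL-Combinatorics.Orbits"
    "HOL-Computational_Algebra.Polynomial"
    "HOL-Library.Numeral_Type"
begin

text \<open>
  A ribbon graph is given by a finite multigraph, a clockwise cyclic order of the half-edges at
  every vertex, and the set of half-twisted edges. As in the theory of bidirected digraphs, the
  arcs are the half-edges: the half-edge \<open>h\<close> sits at the vertex \<open>tail h\<close>, and \<open>opp h\<close> is the
  other half of its edge. Hence a loop contributes two half-edges to its vertex, and
  \<open>out_degree\<close> is the degree of a vertex. \<open>rot h\<close> is the half-edge that follows \<open>h\<close> clockwise.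
\<close>

record ('v, 'h) ribbon_graph =
  graph :: "('v, 'h) pre_digraph"
  opp :: "'h \<Rightarrow> 'h"
  rot :: "'h \<Rightarrow> 'h"
  twisted :: "'h set set"

definition edge_of :: "('v, 'h) ribbon_graph \<Rightarrow> 'h \<Rightarrow> 'h set" where
  "edge_of \<Gamma> h = {h, opp \<Gamma> h}"

definition edges :: "('v, 'h) ribbon_graph \<Rightarrow> 'h set set" where
  "edges \<Gamma> = edge_of \<Gamma> ` arcs (graph \<Gamma>)"

definition is_ribbon_graph :: "('v, 'h) ribbon_graph \<Rightarrow> bool" where
  "is_ribbon_graph \<Gamma> \<longleftrightarrow>
     fin_digraph (graph \<Gamma>) \<and>
     bidirected_digraph (graph \<Gamma>) (opp \<Gamma>) \<and>
     (\<forall>v \<in> verts (graph \<Gamma>). out_arcs (graph \<Gamma>) v \<noteq> {} \<longrightarrow>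
        cyclic_on (rot \<Gamma>) (out_arcs (graph \<Gamma>) v)) \<and>
     twisted \<Gamma> \<subseteq> edges \<Gamma>"

definition trivalent :: "('v, 'h) ribbon_graph \<Rightarrow> bool" where
  "trivalent \<Gamma> \<longleftrightarrow> (\<forall>v \<in> verts (graph \<Gamma>). out_degree (graph \<Gamma>) v = 3)"


subsection \<open>Boundary circles and the Penrose polynomial\<close>

text \<open>
  Look along the ribbon of \<open>h\<close> away from its vertex disc: it meets the boundary of the disc in an
  interval, whose end on the clockwise side is \<open>(h, True)\<close> and whose end on the anticlockwise side
  is \<open>(h, False)\<close>. The boundary of the ribbon surface consists of the arcs of the vertex discs
  between consecutive ribbons (these are the cycle edges of the blowup) and of the sides of
  the ribbons. An untwisted ribbon joins the clockwise side at one end to the anticlockwise side at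
  the other end; a half-twisted one joins equal sides. The disc of a vertex without
  half-edges contributes one more circle.
\<close>

definition ribbon_corners :: "('v, 'h) ribbon_graph \<Rightarrow> ('h \<times> bool) set" where
  "ribbon_corners \<Gamma> = arcs (graph \<Gamma>) \<times> UNIV"

definition boundary_steps :: "('v, 'h) ribbon_graph \<Rightarrow> (('h \<times> bool) \<times> ('h \<times> bool)) set" where
  "boundary_steps \<Gamma> =
     {((h, True), (rot \<Gamma> h, False)) | h. h \<in> arcs (graph \<Gamma>)} \<union>
     {((h, b), (opp \<Gamma> h, if edge_of \<Gamma> h \<in> twisted \<Gamma> then b else \<not> b)) | h b.
        h \<in> arcs (graph \<Gamma>)}"

definition num_boundary_circles :: "('v, 'h) ribbon_graph \<Rightarrow> nat" where
  "num_boundary_circles \<Gamma> =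
     card (ribbon_corners \<Gamma> // (boundary_steps \<Gamma> \<union> (boundary_steps \<Gamma>)\<inverse>)\<^sup>*) +
     card {v \<in> verts (graph \<Gamma>). out_degree (graph \<Gamma>) v = 0}"

definition add_half_twists :: "'h set set \<Rightarrow> ('v, 'h) ribbon_graph \<Rightarrow> ('v, 'h) ribbon_graph" where
  "add_half_twists A \<Gamma> = \<Gamma>\<lparr>twisted := sym_diff (twisted \<Gamma>) A\<rparr>"

definition penrose_polynomial :: "('v, 'h) ribbon_graph \<Rightarrow> rat poly" where
  "penrose_polynomial \<Gamma> =
     (\<Sum>A \<in> Pow (edges \<Gamma>).
        monom ((-1) ^ card A) (num_boundary_circles (add_half_twists A \<Gamma>)))"

abbreviation penrose_bracket :: "('v, 'h) ribbon_graph \<Rightarrow> rat \<Rightarrow> rat" where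
  "penrose_bracket \<Gamma> n \<equiv> poly (penrose_polynomial \<Gamma>) n"


subsection \<open>Configurations\<close>

definition clockwise_at :: "('v, 'h) ribbon_graph \<Rightarrow> 'v \<Rightarrow> 'h \<Rightarrow> 'h \<Rightarrow> 'h \<Rightarrow> bool" where
  "clockwise_at \<Gamma> v a b c \<longleftrightarrow>
     v \<in> verts (graph \<Gamma>) \<and> distinct [a, b, c] \<and> out_arcs (graph \<Gamma>) v = {a, b, c} \<and>
     rot \<Gamma> a = b \<and> rot \<Gamma> b = c \<and> rot \<Gamma> c = a"

text \<open>
  The index type \<open>'k\<close> is one of the numeral types, so that indices are taken modulo the number of
  vertices (with \<open>k = 0\<close> in the type \<open>k\<close>). Here \<open>t i\<close> is the half-edge at \<open>v i\<close> of the \<open>i\<close>-th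
  emanating edge, and the edge from \<open>v i\<close> to \<open>v (i + 1)\<close> is represented by its half \<open>c i\<close> at \<open>v i\<close>.
\<close>

definition polygonal_face ::
    "('v, 'h) ribbon_graph \<Rightarrow> ('k :: {finite, comm_ring_1} \<Rightarrow> 'v) \<Rightarrow> ('k \<Rightarrow> 'h) \<Rightarrow> bool" where
  "polygonal_face \<Gamma> v t \<longleftrightarrow> inj v \<and>
     (\<exists>c. \<forall>i. clockwise_at \<Gamma> (v i) (t i) (c i) (opp \<Gamma> (c (i - 1))) \<and>
              edge_of \<Gamma> (c i) \<notin> twisted \<Gamma>)"

text \<open>
  In the following predicates, \<open>W\<close> is the set of all vertices inside the disc, and \<open>s\<close> gives the
  ends (half-edges) of the five spokes at these vertices.
\<close>

definition pentagon_config :: "('v, 'h) ribbon_graph \<Rightarrow> 'v set \<Rightarrow> (5 \<Rightarrow> 'h) \<Rightarrow> bool" where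
  "pentagon_config \<Gamma> W s \<longleftrightarrow> (\<exists>v :: 5 \<Rightarrow> 'v. polygonal_face \<Gamma> v s \<and> W = range v)"

definition Q_config :: "('v, 'h) ribbon_graph \<Rightarrow> 'v set \<Rightarrow> (5 \<Rightarrow> 'h) \<Rightarrow> bool" where
  "Q_config \<Gamma> W s \<longleftrightarrow>
     (\<exists>(v :: 4 \<Rightarrow> 'v) t w f.
        polygonal_face \<Gamma> v t \<and> t 1 = s 1 \<and> t 2 = s 2 \<and> t 3 = s 3 \<and> t 4 = f \<and>
        w \<notin> range v \<and> clockwise_at \<Gamma> w (s 4) (s 5) (opp \<Gamma> f) \<and> edge_of \<Gamma> f \<notin> twisted \<Gamma> \<and>
        W = insert w (range v))"

definition T_config :: "5 \<Rightarrow> ('v, 'h) ribbon_graph \<Rightarrow> 'v set \<Rightarrow> (5 \<Rightarrow> 'h) \<Rightarrow> bool" where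
  "T_config m \<Gamma> W s \<longleftrightarrow>
     (\<exists>x y z f g.
        distinct [x, y, z] \<and>
        clockwise_at \<Gamma> x (s m) f g \<and>
        clockwise_at \<Gamma> y (s (m + 1)) (s (m + 2)) (opp \<Gamma> f) \<and>
        clockwise_at \<Gamma> z (s (m + 3)) (s (m + 4)) (opp \<Gamma> g) \<and>
        edge_of \<Gamma> f \<notin> twisted \<Gamma> \<and> edge_of \<Gamma> g \<notin> twisted \<Gamma> \<and>
        W = {x, y, z})"


subsection \<open>Replacement inside the disc\<close>

text \<open>
  The spoke ends belong to both sides of the disc boundary: the half-edges, the pairing into edges
  and the twists of the spokes are kept, only their attachment to a vertex changes.
\<close>

definition outer_half_edges :: "('v, 'h) ribbon_graph \<Rightarrow> 'v set \<Rightarrow> (5 \<Rightarrow> 'h) \<Rightarrow> 'h set" where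
  "outer_half_edges \<Gamma> W s = {h \<in> arcs (graph \<Gamma>). tail (graph \<Gamma>) h \<notin> W \<or> h \<in> range s}"

definition same_outside ::
    "(5 \<Rightarrow> 'h) \<Rightarrow> ('v, 'h) ribbon_graph \<Rightarrow> 'v set \<Rightarrow> ('v, 'h) ribbon_graph \<Rightarrow> 'v set \<Rightarrow> bool" where
  "same_outside s \<Gamma> W \<Gamma>' W' \<longleftrightarrow>
     verts (graph \<Gamma>) - W = verts (graph \<Gamma>') - W' \<and>
     outer_half_edges \<Gamma> W s = outer_half_edges \<Gamma>' W' s \<and>
     (\<forall>h \<in> outer_half_edges \<Gamma> W s.
        opp \<Gamma> h = opp \<Gamma>' h \<and>
        (edge_of \<Gamma> h \<in> twisted \<Gamma> \<longleftrightarrow> edge_of \<Gamma>' h \<in> twisted \<Gamma>')) \<and>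
     (\<forall>h \<in> outer_half_edges \<Gamma> W s - range s.
        tail (graph \<Gamma>) h = tail (graph \<Gamma>') h \<and> rot \<Gamma> h = rot \<Gamma>' h)"

text \<open>
  \<open>\<Gamma>'\<close> arises from \<open>\<Gamma>\<close> by replacing the part with vertex set \<open>W\<close> by the configuration \<open>conf\<close> on the
  same spoke ends. The names of the new vertices and half-edges are arbitrary.
\<close>

definition replaced_by ::
    "('v, 'h) ribbon_graph \<Rightarrow> 'v set \<Rightarrow> (5 \<Rightarrow> 'h) \<Rightarrow>
     (('v, 'h) ribbon_graph \<Rightarrow> 'v set \<Rightarrow> (5 \<Rightarrow> 'h) \<Rightarrow> bool) \<Rightarrow> ('v, 'h) ribbon_graph \<Rightarrow> bool" where
  "replaced_by \<Gamma> W s conf \<Gamma>' \<longleftrightarrow>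
     is_ribbon_graph \<Gamma>' \<and> (\<exists>W'. conf \<Gamma>' W' s \<and> same_outside s \<Gamma> W \<Gamma>' W')"

end

theory Submission
  imports Defs "HOL-Library.FuncSet"
begin

text \<open>
  At \<open>n = 4\<close> every boundary circle carries one of four colours, a basis vector of the quaternions.
  The difference of the two smoothings of an edge is the projection of
  \<open>\<real>\<^sup>4 \<otimes> \<real>\<^sup>4\<close> onto the alternating part \<open>so(4) = so(3) \<oplus> so(3)\<close> (up to a scalar), so it is a sum
  over the six elements of a basis ("hues": a chirality and an axis) of products of one factor for each
  half-edge. A trivalent vertex then becomes the trace of three basis elements, which is
  \<open>\<plusminus>4\<close> times the Levi-Civita symbol of the axes if the three chiralities agree, and zero otherwise;
  a twist only changes the sign of an edge. For fixed hues of the spokes, the inside of the disc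
  contributes a tensor contracted from Levi-Civita symbols, and the theorem
  reduces to a linear relation between these tensors on \<open>so(3)\<close>.
\<close>

subsection \<open>Levi-Civita symbols and a basis of so(4)\<close>

datatype axis = X | Y | Z

lemma UNIV_axis: "UNIV = {X, Y, Z}"
  using axis.exhaust by auto

instance axis :: finite
  by standard (simp add: UNIV_axis)

lemma sum_axis: "(\<Sum>x\<in>UNIV. f x) = f X + f Y + f Z" for f :: "axis \<Rightarrow> rat"
  by (simp add: UNIV_axis add.assoc)

fun eps :: "axis \<Rightarrow> axis \<Rightarrow> axis \<Rightarrow> rat" where
  "eps X Y Z = 1" | "eps Y Z X = 1" | "eps Z X Y = 1"
| "eps X Z Y = -1" | "eps Z Y X = -1" | "eps Y X Z = -1"
| "eps _ _ _ = 0"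

text \<open>\<open>None\<close> stands for the quaternion 1 and \<open>Some a\<close> for the
  imaginary unit of axis \<open>a\<close>. The Boolean of a hue is its chirality.\<close>

type_synonym colour = "axis option"
type_synonym hue = "bool \<times> axis"

text \<open>
  The matrices of the multiplication by the unit quaternions from the right (chirality
  \<^term>\<open>True\<close>) and from the left (\<^term>\<open>False\<close>); they are also known as 't Hooft symbols.
\<close>

fun hooft :: "hue \<Rightarrow> colour \<Rightarrow> colour \<Rightarrow> rat" where
  "hooft (\<sigma>, a) None None = 0"
| "hooft (\<sigma>, a) None (Some b) = - of_bool (a = b)"
| "hooft (\<sigma>, a) (Some b) None = of_bool (a = b)"
| "hooft (\<sigma>, a) (Some b) (Some c) = (if \<sigma> then 1 else - 1) * eps a b c"

lemma UNIV_colour: "UNIV = {None, Some X, Some Y, Some Z}"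
  by (auto simp: UNIV_axis UNIV_option_conv)

lemma sum_colour: "(\<Sum>x\<in>UNIV. f x) = f None + f (Some X) + f (Some Y) + f (Some Z)"
  for f :: "colour \<Rightarrow> rat"
  by (simp add: UNIV_colour add.assoc)

lemma sum_hue:
  "(\<Sum>k\<in>UNIV. f k) = (\<Sum>a\<in>UNIV. f (True, a)) + (\<Sum>a\<in>UNIV. f (False, a))"
  for f :: "hue \<Rightarrow> rat"
  by (simp add: UNIV_Times_UNIV[symmetric] sum.cartesian_product' UNIV_bool
      del: UNIV_Times_UNIV)

text \<open>The six antisymmetric matrices are pairwise orthogonal with squared norm 4, hence a
  basis of so(4). Their completeness relation is four times the projection onto antisymmetric
  matrices, which is a difference of two pairings of the indices: the two smoothings of an
  edge.\<close>

lemma hooft_completeness: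
  "(\<Sum>k\<in>UNIV. hooft k a b * hooft k c d) =
     - 2 * (of_bool (a = d \<and> b = c) - of_bool (a = c \<and> b = d))"
proof -
  have "a \<in> {None, Some X, Some Y, Some Z}" "b \<in> {None, Some X, Some Y, Some Z}"
       "c \<in> {None, Some X, Some Y, Some Z}" "d \<in> {None, Some X, Some Y, Some Z}"
    using UNIV_colour by blast+
  then show ?thesis
    by (elim insertE emptyE) (simp_all add: sum_hue sum_axis)
qed

definition vertex_weight :: "hue \<Rightarrow> hue \<Rightarrow> hue \<Rightarrow> rat" where
  "vertex_weight k l m =
     (if fst k = fst l \<and> fst l = fst m
      then (if fst k then - 4 else 4) * eps (snd k) (snd l) (snd m) else 0)"

text \<open>The map \<open>x -> p x q\<close> on quaternions has trace 4 Re(p) Re(q). With mixed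
  chiralities one of \<open>p\<close>, \<open>q\<close> is a single imaginary unit, so the trace
  vanishes; with equal chiralities it is four times the real part of a product of three imaginary
  units.\<close>

lemma hooft_trace:
  "(\<Sum>x\<in>UNIV. \<Sum>y\<in>UNIV. \<Sum>z\<in>UNIV. hooft k y x * hooft l z y * hooft m x z) =
     vertex_weight k l m"
proof -
  obtain s a t b u c where k: "k = (s, a)" "l = (t, b)" "m = (u, c)"
    by (metis surj_pair)
  show ?thesis
    unfolding k
    by (cases s; cases t; cases u; cases a; cases b; cases c)
       (simp_all add: sum_colour vertex_weight_def)
qed

section \<open>Contracting cycles and trees of Levi-Civita symbols\<close>

lemma eps_contract:
  "(\<Sum>x\<in>UNIV. eps a x y * eps b z x) =
     of_bool (y = b) * of_bool (a = z) - of_bool (y = z) * of_bool (a = b)"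
  by (cases a; cases b; cases y; cases z) (simp_all add: sum_axis)

text \<open>\<open>l1\<close> to \<open>l5\<close> are the axes on the sides of the pentagon. Each
  symbol lists spoke, outgoing side and incoming side, which is the clockwise order at that
  corner.\<close>

definition pentagon_axes :: "axis \<Rightarrow> axis \<Rightarrow> axis \<Rightarrow> axis \<Rightarrow> axis \<Rightarrow> rat" where
  "pentagon_axes a b c d e =
     (\<Sum>l1\<in>UNIV. \<Sum>l2\<in>UNIV. \<Sum>l3\<in>UNIV. \<Sum>l4\<in>UNIV. \<Sum>l5\<in>UNIV.
        eps a l1 l5 * (eps b l2 l1 * (eps c l3 l2 * (eps d l4 l3 * eps e l5 l4))))"

definition quadrilateral_axes :: "axis \<Rightarrow> axis \<Rightarrow> axis \<Rightarrow> axis \<Rightarrow> rat" where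
  "quadrilateral_axes a b c d =
     (\<Sum>l1\<in>UNIV. \<Sum>l2\<in>UNIV. \<Sum>l3\<in>UNIV. \<Sum>l4\<in>UNIV.
        eps a l1 l4 * (eps b l2 l1 * (eps c l3 l2 * eps d l4 l3)))"

text \<open>In each term of \<open>eps_contract\<close> that involves \<open>z\<close>, a delta
  substitutes that index in the third symbol, so a chain of three symbols still has only two
  terms.\<close>

lemma eps_contract3:
  "(\<Sum>z\<in>UNIV. (\<Sum>x\<in>UNIV. eps a x y * eps b z x) * eps c w z) =
     of_bool (y = b) * eps c w a - of_bool (a = b) * eps c w y"
  by (cases a; cases b; cases y) (simp_all add: sum_axis)

text \<open>The cycle is cut at two sides into a chain of three corners and a chain of two. Both
  chains have closed forms, so only the sum over the two cut sides remains.\<close>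

lemma pentagon_axes_eq:
  "pentagon_axes a b c d e =
     of_bool (b = d) * eps c e a - of_bool (d = e) * eps c b a - of_bool (a = b) * eps c e d"
proof -
  \<comment> \<open>The cut sides are \<open>y = l5\<close> and \<open>w = l3\<close>; the inner
    ones are \<open>x = l1\<close>, \<open>z = l2\<close> and \<open>v = l4\<close>.\<close>
  have "pentagon_axes a b c d e =
    (\<Sum>y\<in>UNIV. \<Sum>w\<in>UNIV. (\<Sum>z\<in>UNIV. (\<Sum>x\<in>UNIV. eps a x y * eps b z x) * eps c w z) *
       (\<Sum>v\<in>UNIV. eps d v w * eps e y v))"
    unfolding pentagon_axes_def
    by (simp add: sum_axis) (simp add: algebra_simps)
  also have "\<dots> = of_bool (b = d) * eps c e a - of_bool (d = e) * eps c b a - of_bool (a = b) * eps c e d"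
    unfolding eps_contract3 eps_contract
    by (cases a; cases b; cases d; cases e) (simp_all add: sum_axis)
  finally show ?thesis .
qed

text \<open>Here the cut yields two chains of two corners, each evaluated by
  \<open>eps_contract\<close>.\<close>

lemma quadrilateral_axes_eq:
  "quadrilateral_axes a b c d =
     of_bool (b = c) * of_bool (a = d) + of_bool (a = b) * of_bool (c = d)"
proof -
  have "quadrilateral_axes a b c d =
    (\<Sum>y\<in>UNIV. \<Sum>z\<in>UNIV. (\<Sum>x\<in>UNIV. eps a x y * eps b z x) *
       (\<Sum>v\<in>UNIV. eps c v z * eps d y v))"
    unfolding quadrilateral_axes_def
    by (simp add: sum_axis) (simp add: algebra_simps)
  also have "\<dots> = of_bool (b = c) * of_bool (a = d) + of_bool (a = b) * of_bool (c = d)"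
    unfolding eps_contract
    by (cases a; cases b; cases c; cases d) (simp_all add: sum_axis)
  finally show ?thesis .
qed

definition quadrilateral_tree_axes where
  "quadrilateral_tree_axes a b c d e = (\<Sum>f\<in>UNIV. quadrilateral_axes a b c f * eps d e f)"

definition tree_axes where
  "tree_axes a b c d e = (\<Sum>f\<in>UNIV. \<Sum>g\<in>UNIV. eps a f g * (eps b c f * eps d e g))"

text \<open>The seven tensors are SO(3)-invariants of five vectors. These form a space of dimension
  6, so a linear relation must exist; this one is checked on all 3^5 tuples of axes. The cyclic
  shifts of the arguments are the trees rooted at the spokes 2, 3, 4, 5, 1.\<close>

lemma axes_identity:
  "pentagon_axes a b c d e =
     3 / 2 * quadrilateral_tree_axes a b c d e
     + 2 * tree_axes b c d e a + 1 / 2 * tree_axes c d e a b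
     - tree_axes d e a b c - tree_axes e a b c d + 1 / 2 * tree_axes a b c d e"
  unfolding pentagon_axes_eq quadrilateral_tree_axes_def quadrilateral_axes_eq tree_axes_def
  by (cases a; cases b; cases c; cases d; cases e) (simp_all add: sum_axis)

section \<open>From axes to hues: the tensors of the three configurations\<close>

definition pentagon_weight :: "hue \<Rightarrow> hue \<Rightarrow> hue \<Rightarrow> hue \<Rightarrow> hue \<Rightarrow> rat" where
  "pentagon_weight a b c d e = (- (1 / 2)) ^ 5 *
     (\<Sum>l1\<in>UNIV. \<Sum>l2\<in>UNIV. \<Sum>l3\<in>UNIV. \<Sum>l4\<in>UNIV. \<Sum>l5\<in>UNIV.
        vertex_weight a l1 l5 * (vertex_weight b l2 l1 * (vertex_weight c l3 l2 *
          (vertex_weight d l4 l3 * vertex_weight e l5 l4))))"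

definition quadrilateral_weight :: "hue \<Rightarrow> hue \<Rightarrow> hue \<Rightarrow> hue \<Rightarrow> hue \<Rightarrow> rat" where
  "quadrilateral_weight a b c d e = (- (1 / 2)) ^ 5 *
     (\<Sum>f\<in>UNIV. \<Sum>l1\<in>UNIV. \<Sum>l2\<in>UNIV. \<Sum>l3\<in>UNIV. \<Sum>l4\<in>UNIV.
        vertex_weight a l1 l4 * (vertex_weight b l2 l1 * (vertex_weight c l3 l2 *
          (vertex_weight f l4 l3 * vertex_weight d e f))))"

definition tree_weight :: "hue \<Rightarrow> hue \<Rightarrow> hue \<Rightarrow> hue \<Rightarrow> hue \<Rightarrow> rat" where
  "tree_weight a b c d e = (- (1 / 2)) ^ 2 *
     (\<Sum>f\<in>UNIV. \<Sum>g\<in>UNIV.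
        vertex_weight a f g * (vertex_weight b c f * vertex_weight d e g))"

lemma vertex_weight_same: "vertex_weight (s, a) (s, b) (s, c) = (if s then - 4 else 4) * eps a b c"
  by (simp add: vertex_weight_def)

lemma vertex_weight_diff:
  "fst k \<noteq> fst l \<Longrightarrow> vertex_weight k l m = 0" "fst k \<noteq> fst m \<Longrightarrow> vertex_weight k l m = 0"
  "fst l \<noteq> fst m \<Longrightarrow> vertex_weight k l m = 0"
  by (auto simp: vertex_weight_def)

definition unmixed :: "hue \<Rightarrow> hue \<Rightarrow> hue \<Rightarrow> hue \<Rightarrow> hue \<Rightarrow> bool" where
  "unmixed a b c d e \<longleftrightarrow> fst a = fst b \<and> fst b = fst c \<and> fst c = fst d \<and> fst d = fst e"

text \<open>A nonzero vertex weight needs a single chirality, and inner edges connect all vertices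
  of a configuration. Spokes of different chirality therefore force a zero factor in every
  summand.\<close>

lemma weight_mixed:
  assumes "\<not> unmixed a b c d e"
  shows "pentagon_weight a b c d e = 0" "quadrilateral_weight a b c d e = 0"
    "tree_weight a b c d e = 0"
proof -
  have "vertex_weight a l1 l5 * (vertex_weight b l2 l1 * (vertex_weight c l3 l2 *
          (vertex_weight d l4 l3 * vertex_weight e l5 l4))) = 0" for l1 l2 l3 l4 l5
    using assms unfolding unmixed_def vertex_weight_def by auto
  then show "pentagon_weight a b c d e = 0"
    unfolding pentagon_weight_def by (simp only: sum.neutral_const mult_zero_right)
  have "vertex_weight a l1 l4 * (vertex_weight b l2 l1 * (vertex_weight c l3 l2 *
          (vertex_weight f l4 l3 * vertex_weight d e f))) = 0" for l1 l2 l3 l4 f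
    using assms unfolding unmixed_def vertex_weight_def by auto
  then show "quadrilateral_weight a b c d e = 0"
    unfolding quadrilateral_weight_def by (simp only: sum.neutral_const mult_zero_right)
  have "vertex_weight a f g * (vertex_weight b c f * vertex_weight d e g) = 0" for f g
    using assms unfolding unmixed_def vertex_weight_def by auto
  then show "tree_weight a b c d e = 0"
    unfolding tree_weight_def by (simp only: sum.neutral_const mult_zero_right)
qed

text \<open>Once the spokes have chirality \<open>s\<close>, this reduces the sum over the hue of an
  inner edge to a sum over its axis.\<close>

lemma sum_hue_side:
  fixes f :: "hue \<Rightarrow> rat"
  assumes "\<And>l. fst l \<noteq> s \<Longrightarrow> f l = 0"
  shows "(\<Sum>l\<in>UNIV. f l) = (\<Sum>x\<in>UNIV. f (s, x))"
  using assms by (cases s) (simp_all add: sum_hue)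

text \<open>Each inner edge contributes -1/2 and each vertex -4 or 4 according to the chirality.
  Pentagon and quadrilateral configuration have five edges and five vertices, so
  \<open>(-1/2)^5 * (-4)^5 = 32\<close>; a tree has two edges and three vertices, so
  \<open>(1/4) * (-64) = -16\<close>. Both numbers of vertices are odd, so the other chirality flips
  both signs.\<close>

lemma weight_unmixed:
  shows "pentagon_weight (s, a) (s, b) (s, c) (s, d) (s, e) =
      (if s then 32 else - 32) * pentagon_axes a b c d e"
    and "quadrilateral_weight (s, a) (s, b) (s, c) (s, d) (s, e) =
      (if s then 32 else - 32) * quadrilateral_tree_axes a b c d e"
    and "tree_weight (s, a) (s, b) (s, c) (s, d) (s, e) =
      (if s then - 16 else 16) * tree_axes a b c d e"
proof -
  have half: "(- (1 / 2)) ^ 5 = - (1 / 32 :: rat)" "(- (1 / 2)) ^ 2 = (1 / 4 :: rat)"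
    by (simp_all add: power_divide)
  show "pentagon_weight (s, a) (s, b) (s, c) (s, d) (s, e) =
      (if s then 32 else - 32) * pentagon_axes a b c d e"
    unfolding pentagon_weight_def pentagon_axes_def half
    by (simp add: sum_hue_side[where s = s] vertex_weight_same vertex_weight_diff
        sum_distrib_left mult.assoc)
  show "quadrilateral_weight (s, a) (s, b) (s, c) (s, d) (s, e) =
      (if s then 32 else - 32) * quadrilateral_tree_axes a b c d e"
    unfolding quadrilateral_weight_def quadrilateral_tree_axes_def quadrilateral_axes_def half
    by (simp add: sum_hue_side[where s = s] vertex_weight_same vertex_weight_diff
        sum_distrib_left sum_distrib_right mult_ac)
  show "tree_weight (s, a) (s, b) (s, c) (s, d) (s, e) =
      (if s then - 16 else 16) * tree_axes a b c d e"
    unfolding tree_weight_def tree_axes_def half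
    by (simp add: sum_hue_side[where s = s] vertex_weight_same vertex_weight_diff
        sum_distrib_left mult.assoc)
qed

text \<open>Relative to the other two weights a tree weight carries the factor -1/2. Passing from
  axes to hues thus multiplies the tree coefficients of \<open>axes_identity\<close> by -2.\<close>

lemma weight_identity:
  "pentagon_weight a b c d e =
     3 / 2 * quadrilateral_weight a b c d e
     - 4 * tree_weight b c d e a - tree_weight c d e a b
     + 2 * tree_weight d e a b c + 2 * tree_weight e a b c d - tree_weight a b c d e"
proof (cases "unmixed a b c d e")
  case True
  then have "a = (fst a, snd a)" "b = (fst a, snd b)" "c = (fst a, snd c)" "d = (fst a, snd d)"
      "e = (fst a, snd e)"
    by (simp_all add: unmixed_def prod_eq_iff)
  then obtain s a' b' c' d' e'
    where "a = (s, a')" "b = (s, b')" "c = (s, c')" "d = (s, d')" "e = (s, e')"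
    by blast
  then show ?thesis
    by (simp add: weight_unmixed axes_identity algebra_simps)
next
  case False
  moreover from this have "\<not> unmixed b c d e a" "\<not> unmixed c d e a b" "\<not> unmixed d e a b c"
    "\<not> unmixed e a b c d"
    by (auto simp: unmixed_def)
  ultimately show ?thesis
    by (simp add: weight_mixed)
qed

subsection \<open>The state sum\<close>

text \<open>A function that agrees along \<open>R\<close> is a free choice of one value per
  connected component. With four colours this turns the power of 4 for a set of boundary circles
  into a number of colourings.\<close>

lemma card_constant_on_classes:
  fixes R :: "('a \<times> 'a) set"
  assumes "finite C" "R \<subseteq> C \<times> C"
  shows "card {f \<in> C \<rightarrow>\<^sub>E K. \<forall>(x, y)\<in>R. f x = f y} = card K ^ card (C // (R \<union> R\<inverse>)\<^sup>*)"
proof -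
  define r where "r = (R \<union> R\<inverse>)\<^sup>*"
  have equiv: "equiv UNIV r"
    unfolding r_def
    by (intro equivI refl_rtrancl sym_rtrancl trans_rtrancl) (auto simp: sym_Un_converse)
  \<comment> \<open>\<open>r\<close> is reflexive on the whole type, but no step of \<open>R\<close>
    leaves \<open>C\<close>.\<close>
  have inC: "r `` {x} \<subseteq> C" if "x \<in> C" for x
  proof
    fix y assume "y \<in> r `` {x}"
    then have "(x, y) \<in> (R \<union> R\<inverse>)\<^sup>*" by (simp add: r_def)
    then show "y \<in> C"
      by (induction rule: rtrancl_induct) (use that assms in auto)
  qed
  have fin: "finite (C // r)"
    unfolding quotient_def using assms(1) by simp
  let ?A = "(C // r) \<rightarrow>\<^sub>E K" and ?B = "{f \<in> C \<rightarrow>\<^sub>E K. \<forall>(x, y)\<in>R. f x = f y}"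
  have const: "f x = f y" if "f \<in> ?B" "(x, y) \<in> r" for f x y
    using that(2) unfolding r_def
    by (induction rule: rtrancl_induct) (use that(1) in auto)
  have "bij_betw (\<lambda>g. \<lambda>x\<in>C. g (r `` {x})) ?A ?B"
  \<comment> \<open>The inverse map evaluates a colouring at a chosen representative of each
    class.\<close>
  proof (rule bij_betwI[where g = "\<lambda>f. \<lambda>Q\<in>C // r. f (SOME x. x \<in> Q)"])
    show "(\<lambda>g. \<lambda>x\<in>C. g (r `` {x})) \<in> ?A \<rightarrow> ?B"
    proof
      fix g assume g: "g \<in> ?A"
      have "r `` {x} = r `` {y}" if "(x, y) \<in> R" for x y
        using that by (intro equiv_class_eq[OF equiv]) (auto simp: r_def)
      moreover have "x \<in> C" "y \<in> C" if "(x, y) \<in> R" for x y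
        using that assms(2) by auto
      ultimately show "(\<lambda>x\<in>C. g (r `` {x})) \<in> ?B"
        using g by (auto simp: quotientI PiE_iff)
    qed
    have some: "(SOME x. x \<in> Q) \<in> Q" if "Q \<in> C // r" for Q
    proof -
      from that obtain x where "Q = r `` {x}" by (auto elim: quotientE)
      then have "x \<in> Q" using equiv_class_self[OF equiv] by auto
      then show ?thesis by (rule someI)
    qed
    show "(\<lambda>f. \<lambda>Q\<in>C // r. f (SOME x. x \<in> Q)) \<in> ?B \<rightarrow> ?A"
    proof
      fix f assume f: "f \<in> ?B"
      have "(SOME x. x \<in> Q) \<in> C" if "Q \<in> C // r" for Q
        using some[OF that] that inC by (auto simp: quotient_def)
      with f show "(\<lambda>Q\<in>C // r. f (SOME x. x \<in> Q)) \<in> ?A"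
        by (auto simp: PiE_iff)
    qed
    show "(\<lambda>Q\<in>C // r. (\<lambda>x\<in>C. g (r `` {x})) (SOME x. x \<in> Q)) = g" if "g \<in> ?A" for g
    proof
      fix Q
      show "(\<lambda>Q\<in>C // r. (\<lambda>x\<in>C. g (r `` {x})) (SOME x. x \<in> Q)) Q = g Q"
      proof (cases "Q \<in> C // r")
        case True
        then obtain x where x: "x \<in> C" "Q = r `` {x}" by (auto simp: quotient_def)
        define y where "y = (SOME x. x \<in> Q)"
        have "y \<in> Q" using some[OF True] by (simp add: y_def)
        then have "y \<in> C" "r `` {y} = Q"
          using inC[OF x(1)] equiv_class_eq[OF equiv, of x y] by (auto simp: x(2))
        with True show ?thesis by (simp add: y_def[symmetric])
      qed (use that in auto)
    qed
    show "(\<lambda>x\<in>C. (\<lambda>Q\<in>C // r. f (SOME x. x \<in> Q)) (r `` {x})) = f" if f: "f \<in> ?B" for f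
    proof
      fix x
      show "(\<lambda>x\<in>C. (\<lambda>Q\<in>C // r. f (SOME x. x \<in> Q)) (r `` {x})) x = f x"
      proof (cases "x \<in> C")
        case True
        then have "(x, SOME y. y \<in> r `` {x}) \<in> r"
          using some[OF quotientI[OF True]] by simp
        with True const[OF f] show ?thesis by (auto simp: quotientI)
      qed (use f in auto)
    qed
  qed
  from bij_betw_same_card[OF this] fin show ?thesis
    by (simp add: card_funcsetE r_def)
qed

text \<open>Distributivity: a function on a disjoint union is an independent choice of functions on
  the pieces.\<close>

lemma sum_PiE_UN_prod:
  assumes "finite I" "\<And>i. i \<in> I \<Longrightarrow> finite (S i)" "disjoint_family_on S I" "finite K"
  shows "(\<Sum>p\<in>(\<Union>i\<in>I. S i) \<rightarrow>\<^sub>E K. \<Prod>i\<in>I. F i (restrict p (S i))) =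
         (\<Prod>i\<in>I. \<Sum>p\<in>S i \<rightarrow>\<^sub>E K. F i p :: 'b :: comm_semiring_1)"
proof -
  have "(\<Prod>i\<in>I. \<Sum>p\<in>S i \<rightarrow>\<^sub>E K. F i p) =
      (\<Sum>P\<in>(\<Pi>\<^sub>E i\<in>I. S i \<rightarrow>\<^sub>E K). \<Prod>i\<in>I. F i (P i))"
    using assms by (intro prod_sum_PiE) (auto intro: finite_PiE)
  also have "\<dots> = (\<Sum>p\<in>(\<Union>i\<in>I. S i) \<rightarrow>\<^sub>E K. \<Prod>i\<in>I. F i (restrict p (S i)))"
  \<comment> \<open>Local functions are glued to a global one; the piece containing a point is
    unique by disjointness.\<close>
  proof (rule sum.reindex_bij_witness[where
        i = "\<lambda>p. \<lambda>i\<in>I. restrict p (S i)" and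
        j = "\<lambda>P. \<lambda>x\<in>(\<Union>i\<in>I. S i). P (THE i. i \<in> I \<and> x \<in> S i) x"])
    have the: "(THE j. j \<in> I \<and> x \<in> S j) = i" if "i \<in> I" "x \<in> S i" for i x
      using that assms(3) by (intro the_equality) (auto simp: disjoint_family_on_def)
    fix P assume P: "P \<in> (\<Pi>\<^sub>E i\<in>I. S i \<rightarrow>\<^sub>E K)"
    let ?j = "\<lambda>x\<in>(\<Union>i\<in>I. S i). P (THE i. i \<in> I \<and> x \<in> S i) x"
    have r: "restrict ?j (S i) = P i" if "i \<in> I" for i
    proof
      fix x show "restrict ?j (S i) x = P i x"
        using P that by (cases "x \<in> S i") (auto simp: the PiE_iff extensional_def)
    qed
    then show "(\<lambda>i\<in>I. restrict ?j (S i)) = P"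
      using P by (auto simp: fun_eq_iff PiE_iff extensional_def)
    show "?j \<in> (\<Union>i\<in>I. S i) \<rightarrow>\<^sub>E K"
      using P by (auto simp: the PiE_iff)
    show "(\<Prod>i\<in>I. F i (restrict ?j (S i))) = (\<Prod>i\<in>I. F i (P i))"
      by (intro prod.cong refl arg_cong2[where f = F]) (rule r)
  next
    have the: "(THE j. j \<in> I \<and> x \<in> S j) = i" if "i \<in> I" "x \<in> S i" for i x
      using that assms(3) by (intro the_equality) (auto simp: disjoint_family_on_def)
    fix p assume p: "p \<in> (\<Union>i\<in>I. S i) \<rightarrow>\<^sub>E K"
    then show "(\<lambda>i\<in>I. restrict p (S i)) \<in> (\<Pi>\<^sub>E i\<in>I. S i \<rightarrow>\<^sub>E K)"
      by (auto simp: PiE_iff)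
    show "(\<lambda>x\<in>(\<Union>i\<in>I. S i). (\<lambda>i\<in>I. restrict p (S i)) (THE i. i \<in> I \<and> x \<in> S i) x) = p"
    proof
      fix x
      show "(\<lambda>x\<in>(\<Union>i\<in>I. S i). (\<lambda>i\<in>I. restrict p (S i)) (THE i. i \<in> I \<and> x \<in> S i) x) x = p x"
      proof (cases "x \<in> (\<Union>i\<in>I. S i)")
        case True
        then obtain i where i: "i \<in> I" "x \<in> S i" by blast
        show ?thesis using i by (auto simp: the[OF i])
      qed (use p in \<open>simp add: PiE_iff extensional_def\<close>)
    qed
  qed
  finally show ?thesis by simp
qed

text \<open>Every vertex disc meets a ribbon, so each boundary circle passes through corners and
  \<open>rot\<close> acts cyclically at every vertex.\<close>

locale full_ribbon_graph =
  fixes \<Gamma> :: "('v, 'h) ribbon_graph"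
  assumes ribbon: "is_ribbon_graph \<Gamma>"
    and no_isolated: "v \<in> verts (graph \<Gamma>) \<Longrightarrow> out_arcs (graph \<Gamma>) v \<noteq> {}"
begin

lemma fin_digraph: "fin_digraph (graph \<Gamma>)"
  using ribbon by (simp add: is_ribbon_graph_def)

lemma finite_arcs [simp]: "finite (arcs (graph \<Gamma>))"
  and finite_verts [simp]: "finite (verts (graph \<Gamma>))"
  using fin_digraph by (simp_all add: fin_digraph_def fin_digraph_axioms_def)

lemma finite_edges [simp]: "finite (edges \<Gamma>)"
  by (simp add: edges_def)

lemma tail_in_verts: "h \<in> arcs (graph \<Gamma>) \<Longrightarrow> tail (graph \<Gamma>) h \<in> verts (graph \<Gamma>)"
  using fin_digraph by (simp add: fin_digraph_def wf_digraph_def)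

lemma opp_opp: "h \<in> arcs (graph \<Gamma>) \<Longrightarrow> opp \<Gamma> (opp \<Gamma> h) = h"
  and opp_neq: "h \<in> arcs (graph \<Gamma>) \<Longrightarrow> opp \<Gamma> h \<noteq> h"
  and opp_in_arcs: "h \<in> arcs (graph \<Gamma>) \<Longrightarrow> opp \<Gamma> h \<in> arcs (graph \<Gamma>)"
proof -
  interpret bidirected_digraph "graph \<Gamma>" "opp \<Gamma>"
    using ribbon by (simp add: is_ribbon_graph_def)
  show "opp \<Gamma> (opp \<Gamma> h) = h" "opp \<Gamma> h \<noteq> h" "opp \<Gamma> h \<in> arcs (graph \<Gamma>)"
    if "h \<in> arcs (graph \<Gamma>)"
    using that arev_dom arev_arev_raw by metis+
qed

lemma rot_in_out_arcs:
  assumes "h \<in> out_arcs (graph \<Gamma>) v"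
  shows "rot \<Gamma> h \<in> out_arcs (graph \<Gamma>) v"
proof -
  from assms have "v \<in> verts (graph \<Gamma>)" using tail_in_verts by auto
  then have "cyclic_on (rot \<Gamma>) (out_arcs (graph \<Gamma>) v)"
    using ribbon no_isolated by (simp add: is_ribbon_graph_def)
  then show ?thesis using assms by (rule cyclic_on_inI)
qed

lemma rot_in_arcs: "h \<in> arcs (graph \<Gamma>) \<Longrightarrow> rot \<Gamma> h \<in> arcs (graph \<Gamma>)"
  using rot_in_out_arcs[of h "tail (graph \<Gamma>) h"] by simp

lemma edge_of_opp: "h \<in> arcs (graph \<Gamma>) \<Longrightarrow> edge_of \<Gamma> (opp \<Gamma> h) = edge_of \<Gamma> h"
  by (auto simp: edge_of_def opp_opp)

lemma edge_of_eq: "e \<in> edges \<Gamma> \<Longrightarrow> h \<in> e \<Longrightarrow> edge_of \<Gamma> h = e"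
  by (auto simp: edges_def edge_of_def opp_opp)

lemma edge_in_arcs: "e \<in> edges \<Gamma> \<Longrightarrow> h \<in> e \<Longrightarrow> h \<in> arcs (graph \<Gamma>)"
  by (auto simp: edges_def edge_of_def opp_in_arcs)

lemma Union_edges: "\<Union> (edges \<Gamma>) = arcs (graph \<Gamma>)"
  using edge_in_arcs by (auto simp: edges_def edge_of_def)

lemma UN_out_arcs: "(\<Union>v\<in>verts (graph \<Gamma>). out_arcs (graph \<Gamma>) v) = arcs (graph \<Gamma>)"
  using tail_in_verts by auto

end

section \<open>Local factors and the state sum at n = 4\<close>

text \<open>
  A colouring of the corners that is constant along the boundary of the vertex discs is given by its
  values \<open>p h\<close> at the corners \<open>(h, False)\<close>: the colour of \<open>(h, True)\<close> is then \<open>p (rot h)\<close>.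
\<close>

definition glued :: "('v, 'h) ribbon_graph \<Rightarrow> ('h \<Rightarrow> colour) \<Rightarrow> 'h \<Rightarrow> bool \<Rightarrow> bool" where
  "glued \<Gamma> p h t \<longleftrightarrow>
     (if t then p (rot \<Gamma> h) = p (rot \<Gamma> (opp \<Gamma> h)) \<and> p h = p (opp \<Gamma> h)
      else p (rot \<Gamma> h) = p (opp \<Gamma> h) \<and> p h = p (rot \<Gamma> (opp \<Gamma> h)))"

text \<open>With the hues of the edges fixed, this contracts the half-edge factors at one vertex
  over the colours of the arcs of its disc boundary.\<close>

definition node_sum :: "('v, 'h) ribbon_graph \<Rightarrow> ('h set \<Rightarrow> hue) \<Rightarrow> 'v \<Rightarrow> rat" where
  "node_sum \<Gamma> \<kappa> v =
     (\<Sum>p\<in>out_arcs (graph \<Gamma>) v \<rightarrow>\<^sub>E UNIV.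
        \<Prod>h\<in>out_arcs (graph \<Gamma>) v. hooft (\<kappa> (edge_of \<Gamma> h)) (p (rot \<Gamma> h)) (p h))"

text \<open>-1/2 is the inverse of the constant -2 in \<open>hooft_completeness\<close>. A
  half-twist exchanges the two smoothings and so changes the sign.\<close>

definition edge_sign :: "('v, 'h) ribbon_graph \<Rightarrow> 'h set \<Rightarrow> rat" where
  "edge_sign \<Gamma> e = (if e \<in> twisted \<Gamma> then 1 / 2 else - (1 / 2))"

lemma prod_of_bool:
  "finite A \<Longrightarrow> (\<Prod>x\<in>A. of_bool (P x)) = (of_bool (\<forall>x\<in>A. P x) :: 'a :: comm_semiring_1)"
  by (induction rule: finite_induct) auto

lemma card_axis: "CARD(axis) = 3"
  by (simp add: UNIV_axis)

context full_ribbon_graph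
begin

text \<open>The power counts colourings of the corners that are constant along circles. The disc
  arcs are solved by passing to \<open>p\<close>; what remains is one gluing condition for each
  ribbon.\<close>

lemma power_num_boundary_circles:
  "4 ^ num_boundary_circles (add_half_twists A \<Gamma>) =
     (\<Sum>p\<in>arcs (graph \<Gamma>) \<rightarrow>\<^sub>E UNIV. \<Prod>e\<in>edges \<Gamma>.
        of_bool (\<forall>h\<in>e. glued \<Gamma> p h (e \<in> sym_diff (twisted \<Gamma>) A)) :: rat)"
proof -
  let ?\<Gamma> = "add_half_twists A \<Gamma>" and ?H = "arcs (graph \<Gamma>)"
  let ?T = "sym_diff (twisted \<Gamma>) A"
  let ?C = "?H \<times> (UNIV :: bool set)"
  have [simp]: "graph ?\<Gamma> = graph \<Gamma>" "opp ?\<Gamma> = opp \<Gamma>" "rot ?\<Gamma> = rot \<Gamma>" "twisted ?\<Gamma> = ?T"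
    "edge_of ?\<Gamma> = edge_of \<Gamma>"
    by (simp_all add: add_half_twists_def edge_of_def fun_eq_iff)
  have steps: "boundary_steps ?\<Gamma> \<subseteq> ?C \<times> ?C"
    by (auto simp: boundary_steps_def rot_in_arcs opp_in_arcs)
  have isolated: "{v \<in> verts (graph \<Gamma>). out_degree (graph \<Gamma>) v = 0} = {}"
    using no_isolated finite_subset[OF _ finite_arcs]
    by (auto simp: out_degree_def card_eq_0_iff out_arcs_def)
  \<comment> \<open>The conditions at half-edges are grouped by edges so that they become a product
    over edges.\<close>
  have all_edges: "(\<forall>e\<in>edges \<Gamma>. \<forall>h\<in>e. glued \<Gamma> p h (e \<in> ?T)) \<longleftrightarrow>
      (\<forall>h\<in>?H. glued \<Gamma> p h (edge_of \<Gamma> h \<in> ?T))" for p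
  proof (intro iffI ballI)
    fix h assume "\<forall>e\<in>edges \<Gamma>. \<forall>h\<in>e. glued \<Gamma> p h (e \<in> ?T)" "h \<in> ?H"
    moreover from this have "edge_of \<Gamma> h \<in> edges \<Gamma>" "h \<in> edge_of \<Gamma> h"
      by (simp_all add: edges_def edge_of_def)
    ultimately show "glued \<Gamma> p h (edge_of \<Gamma> h \<in> ?T)" by blast
  next
    fix e h assume "\<forall>h\<in>?H. glued \<Gamma> p h (edge_of \<Gamma> h \<in> ?T)" and e: "e \<in> edges \<Gamma>" "h \<in> e"
    then have "glued \<Gamma> p h (edge_of \<Gamma> h \<in> ?T)" using edge_in_arcs by blast
    then show "glued \<Gamma> p h (e \<in> ?T)" unfolding edge_of_eq[OF e] .
  qed
  let ?A = "{p \<in> ?H \<rightarrow>\<^sub>E (UNIV :: colour set). \<forall>h\<in>?H. glued \<Gamma> p h (edge_of \<Gamma> h \<in> ?T)}"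
  let ?B = "{f \<in> ?C \<rightarrow>\<^sub>E (UNIV :: colour set). \<forall>(x, y)\<in>boundary_steps ?\<Gamma>. f x = f y}"
  have B: "f \<in> ?B \<longleftrightarrow> f \<in> ?C \<rightarrow>\<^sub>E UNIV \<and> (\<forall>h\<in>?H. f (h, True) = f (rot \<Gamma> h, False)) \<and>
      (\<forall>h\<in>?H. \<forall>b. f (h, b) = f (opp \<Gamma> h, if edge_of \<Gamma> h \<in> ?T then b else \<not> b))" for f
  proof -
    have "(\<forall>(x, y)\<in>{((h, True), (r h, False)) | h. h \<in> ?H} \<union> {((h, b), q h b) | h b. h \<in> ?H}. f x = f y) \<longleftrightarrow>
        (\<forall>h\<in>?H. f (h, True) = f (r h, False)) \<and> (\<forall>h\<in>?H. \<forall>b. f (h, b) = f (q h b))" for r q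
      by blast
    from this[of "rot \<Gamma>" "\<lambda>h b. (opp \<Gamma> h, if edge_of \<Gamma> h \<in> ?T then b else \<not> b)"]
    show ?thesis
      unfolding boundary_steps_def by simp
  qed
  let ?j = "\<lambda>p. \<lambda>(h, b)\<in>?C. if b then p (rot \<Gamma> h) else p h"
  have "bij_betw ?j ?A ?B"
  proof (rule bij_betwI[where g = "\<lambda>f. \<lambda>h\<in>?H. f (h, False)"])
    show "?j \<in> ?A \<rightarrow> ?B"
    proof
      fix p assume "p \<in> ?A"
      then show "?j p \<in> ?B"
        unfolding B by (auto simp: rot_in_arcs opp_in_arcs glued_def split: if_splits)
    qed
    show "(\<lambda>f. \<lambda>h\<in>?H. f (h, False)) \<in> ?B \<rightarrow> ?A"
    proof
      fix f assume "f \<in> ?B"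
      then have f1: "\<And>h. h \<in> ?H \<Longrightarrow> f (h, True) = f (rot \<Gamma> h, False)"
        and f2: "\<And>h b. h \<in> ?H \<Longrightarrow> f (h, b) = f (opp \<Gamma> h, if edge_of \<Gamma> h \<in> ?T then b else \<not> b)"
        unfolding B by auto
      have "glued \<Gamma> (\<lambda>h\<in>?H. f (h, False)) h (edge_of \<Gamma> h \<in> ?T)" if h: "h \<in> ?H" for h
        using f2[OF h, of True] f2[OF h, of False] h
        by (simp add: glued_def rot_in_arcs opp_in_arcs f1[symmetric])
      then show "(\<lambda>h\<in>?H. f (h, False)) \<in> ?A" by auto
    qed
    show "(\<lambda>h\<in>?H. ?j p (h, False)) = p" if "p \<in> ?A" for p
      using that by (auto simp: fun_eq_iff PiE_iff extensional_def)
    show "?j (\<lambda>h\<in>?H. f (h, False)) = f" if "f \<in> ?B" for f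
      using that[unfolded B] by (auto simp: fun_eq_iff PiE_iff extensional_def rot_in_arcs)
  qed
  then have "card ?A = card ?B"
    by (rule bij_betw_same_card)
  also have "card ?B = 4 ^ num_boundary_circles ?\<Gamma>"
    using card_constant_on_classes[OF _ steps, of "UNIV :: colour set"]
    by (simp add: num_boundary_circles_def ribbon_corners_def card_axis isolated)
  finally have "4 ^ num_boundary_circles ?\<Gamma> = (of_nat (card ?A) :: rat)"
    by simp
  also have "\<dots> = (\<Sum>p\<in>?H \<rightarrow>\<^sub>E UNIV. of_bool (\<forall>h\<in>?H. glued \<Gamma> p h (edge_of \<Gamma> h \<in> ?T)))"
    by (subst sum_of_bool_eq) (simp_all add: finite_PiE Int_def)
  also have "\<dots> = (\<Sum>p\<in>?H \<rightarrow>\<^sub>E UNIV. \<Prod>e\<in>edges \<Gamma>.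
        of_bool (\<forall>h\<in>e. glued \<Gamma> p h (e \<in> ?T)))"
    unfolding all_edges[symmetric] by (intro sum.cong refl prod_of_bool[symmetric]) simp
  finally show ?thesis .
qed

text \<open>The four colours at the two ends of a ribbon are paired in one of two ways. The
  difference of the pairings is the right-hand side of \<open>hooft_completeness\<close>, which has
  one factor per half-edge.\<close>

lemma edge_factor:
  assumes "e \<in> edges \<Gamma>"
  shows "of_bool (\<forall>h\<in>e. glued \<Gamma> p h (e \<in> twisted \<Gamma>)) -
      of_bool (\<forall>h\<in>e. glued \<Gamma> p h (e \<notin> twisted \<Gamma>)) =
    edge_sign \<Gamma> e * (\<Sum>k\<in>UNIV. \<Prod>h\<in>e. hooft k (p (rot \<Gamma> h)) (p h))"
proof -
  from assms obtain h where h: "h \<in> arcs (graph \<Gamma>)" "e = {h, opp \<Gamma> h}"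
    by (auto simp: edges_def edge_of_def)
  \<comment> \<open>Exchanging the two halves of an edge does not change the gluing condition, so
    one half suffices.\<close>
  have glued: "(\<forall>h\<in>e. glued \<Gamma> p h t) \<longleftrightarrow> glued \<Gamma> p h t" for t
    using h by (auto simp: glued_def opp_opp)
  have "(\<Sum>k\<in>UNIV. \<Prod>h\<in>e. hooft k (p (rot \<Gamma> h)) (p h)) =
      - 2 * (of_bool (glued \<Gamma> p h False) - of_bool (glued \<Gamma> p h True))"
    using opp_neq[OF h(1)] by (simp add: h(2) hooft_completeness glued_def)
  then show ?thesis
    unfolding glued edge_sign_def by simp
qed

text \<open>Expanding the product of differences, \<open>A\<close> collects the edges at which the
  subtracted term is chosen; each of them brings one minus sign.\<close>

lemma sum_over_twists:
  fixes g :: "'h set \<Rightarrow> bool \<Rightarrow> rat"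
  shows "(\<Sum>A\<in>Pow (edges \<Gamma>). (- 1) ^ card A * (\<Prod>e\<in>edges \<Gamma>. g e (e \<in> sym_diff (twisted \<Gamma>) A))) =
    (\<Prod>e\<in>edges \<Gamma>. g e (e \<in> twisted \<Gamma>) - g e (e \<notin> twisted \<Gamma>))"
proof -
  have "(\<Prod>e\<in>edges \<Gamma>. - g e (e \<notin> twisted \<Gamma>) + g e (e \<in> twisted \<Gamma>)) =
      (\<Sum>A\<in>Pow (edges \<Gamma>). (\<Prod>e\<in>A. - g e (e \<notin> twisted \<Gamma>)) *
         (\<Prod>e\<in>edges \<Gamma> - A. g e (e \<in> twisted \<Gamma>)))"
    by (rule prod_add) simp
  also have "\<dots> = (\<Sum>A\<in>Pow (edges \<Gamma>). (- 1) ^ card A *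
      (\<Prod>e\<in>edges \<Gamma>. g e (e \<in> sym_diff (twisted \<Gamma>) A)))"
  proof (intro sum.cong refl)
    fix A assume A: "A \<in> Pow (edges \<Gamma>)"
    have "(\<Prod>e\<in>edges \<Gamma>. g e (e \<in> sym_diff (twisted \<Gamma>) A)) =
        (\<Prod>e\<in>edges \<Gamma> - A. g e (e \<in> sym_diff (twisted \<Gamma>) A)) *
        (\<Prod>e\<in>A. g e (e \<in> sym_diff (twisted \<Gamma>) A))"
      using A by (intro prod.subset_diff) auto
    also have "\<dots> = (\<Prod>e\<in>edges \<Gamma> - A. g e (e \<in> twisted \<Gamma>)) * (\<Prod>e\<in>A. g e (e \<notin> twisted \<Gamma>))"
      by (intro arg_cong2[where f = "(*)"] prod.cong) auto
    finally show "(\<Prod>e\<in>A. - g e (e \<notin> twisted \<Gamma>)) * (\<Prod>e\<in>edges \<Gamma> - A. g e (e \<in> twisted \<Gamma>)) =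
        (- 1) ^ card A * (\<Prod>e\<in>edges \<Gamma>. g e (e \<in> sym_diff (twisted \<Gamma>) A))"
      by (simp add: prod_uminus)
  qed
  finally show ?thesis by simp
qed

text \<open>The half-edge factors, grouped by edges on the left, are regrouped by vertices; the sum
  over colours then factorises.\<close>

lemma sum_over_colours:
  "(\<Sum>p\<in>arcs (graph \<Gamma>) \<rightarrow>\<^sub>E UNIV. \<Prod>e\<in>edges \<Gamma>. \<Prod>h\<in>e. hooft (\<kappa> e) (p (rot \<Gamma> h)) (p h)) =
    (\<Prod>v\<in>verts (graph \<Gamma>). node_sum \<Gamma> \<kappa> v)"
proof -
  let ?F = "\<lambda>v p. \<Prod>h\<in>out_arcs (graph \<Gamma>) v. hooft (\<kappa> (edge_of \<Gamma> h)) (p (rot \<Gamma> h)) (p h)"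
  have fin: "finite (out_arcs (graph \<Gamma>) v)" for v
    by (rule finite_subset[OF _ finite_arcs]) auto
  have "(\<Prod>e\<in>edges \<Gamma>. \<Prod>h\<in>e. hooft (\<kappa> e) (p (rot \<Gamma> h)) (p h)) =
      (\<Prod>v\<in>verts (graph \<Gamma>). ?F v (restrict p (out_arcs (graph \<Gamma>) v)))" for p
  proof -
    have "(\<Prod>e\<in>edges \<Gamma>. \<Prod>h\<in>e. hooft (\<kappa> e) (p (rot \<Gamma> h)) (p h)) =
        (\<Prod>e\<in>edges \<Gamma>. \<Prod>h\<in>e. hooft (\<kappa> (edge_of \<Gamma> h)) (p (rot \<Gamma> h)) (p h))"
      by (intro prod.cong refl) (simp add: edge_of_eq)
    also have "\<dots> = (\<Prod>h\<in>\<Union> (edges \<Gamma>). hooft (\<kappa> (edge_of \<Gamma> h)) (p (rot \<Gamma> h)) (p h))"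
    proof (subst prod.Union_disjoint)
      show "\<forall>e\<in>edges \<Gamma>. finite e" by (auto simp: edges_def edge_of_def)
      show "\<forall>e\<in>edges \<Gamma>. \<forall>e'\<in>edges \<Gamma>. e \<noteq> e' \<longrightarrow> e \<inter> e' = {}" using edge_of_eq by blast
    qed simp
    also have "\<dots> = (\<Prod>h\<in>(\<Union>v\<in>verts (graph \<Gamma>). out_arcs (graph \<Gamma>) v).
        hooft (\<kappa> (edge_of \<Gamma> h)) (p (rot \<Gamma> h)) (p h))"
      unfolding Union_edges UN_out_arcs ..
    also have "\<dots> = (\<Prod>v\<in>verts (graph \<Gamma>). ?F v p)"
      using fin by (subst prod.UNION_disjoint) auto
    \<comment> \<open>\<open>rot\<close> keeps half-edges at their vertex, so the factor of
      \<open>v\<close> only sees the colours at \<open>v\<close>.\<close>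
    also have "\<dots> = (\<Prod>v\<in>verts (graph \<Gamma>). ?F v (restrict p (out_arcs (graph \<Gamma>) v)))"
      using rot_in_out_arcs by (intro prod.cong refl) simp
    finally show ?thesis .
  qed
  then have "(\<Sum>p\<in>arcs (graph \<Gamma>) \<rightarrow>\<^sub>E UNIV. \<Prod>e\<in>edges \<Gamma>. \<Prod>h\<in>e. hooft (\<kappa> e) (p (rot \<Gamma> h)) (p h)) =
      (\<Sum>p\<in>(\<Union>v\<in>verts (graph \<Gamma>). out_arcs (graph \<Gamma>) v) \<rightarrow>\<^sub>E UNIV.
        \<Prod>v\<in>verts (graph \<Gamma>). ?F v (restrict p (out_arcs (graph \<Gamma>) v)))"
    unfolding UN_out_arcs by (intro sum.cong) auto
  also have "\<dots> = (\<Prod>v\<in>verts (graph \<Gamma>). \<Sum>p\<in>out_arcs (graph \<Gamma>) v \<rightarrow>\<^sub>E UNIV. ?F v p)"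
    using fin by (intro sum_PiE_UN_prod) (auto simp: disjoint_family_on_def)
  finally show ?thesis
    unfolding node_sum_def .
qed

text \<open>After exchanging sums, the alternating sum over twists is a product of edge factors.
  Expanding each as a sum over hues gives hue assignments \<open>\<kappa>\<close>, and for fixed
  \<open>\<kappa>\<close> the colours are summed vertex by vertex.\<close>

lemma penrose_state_sum:
  "penrose_bracket \<Gamma> 4 =
    (\<Sum>\<kappa>\<in>edges \<Gamma> \<rightarrow>\<^sub>E UNIV.
       (\<Prod>e\<in>edges \<Gamma>. edge_sign \<Gamma> e) * (\<Prod>v\<in>verts (graph \<Gamma>). node_sum \<Gamma> \<kappa> v))"
proof -
  let ?E = "edges \<Gamma>" and ?H = "arcs (graph \<Gamma>)"
  let ?g = "\<lambda>p e t. of_bool (\<forall>h\<in>e. glued \<Gamma> p h t) :: rat"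
  let ?m = "\<lambda>p e k. \<Prod>h\<in>e. hooft k (p (rot \<Gamma> h)) (p h)"
  have "penrose_bracket \<Gamma> 4 =
      (\<Sum>A\<in>Pow ?E. (- 1) ^ card A *
         (\<Sum>p\<in>?H \<rightarrow>\<^sub>E UNIV. \<Prod>e\<in>?E. ?g p e (e \<in> sym_diff (twisted \<Gamma>) A)))"
    unfolding penrose_polynomial_def poly_sum poly_monom power_num_boundary_circles ..
  also have "\<dots> = (\<Sum>p\<in>?H \<rightarrow>\<^sub>E UNIV. \<Sum>A\<in>Pow ?E. (- 1) ^ card A *
       (\<Prod>e\<in>?E. ?g p e (e \<in> sym_diff (twisted \<Gamma>) A)))"
    unfolding sum_distrib_left by (rule sum.swap)
  also have "\<dots> = (\<Sum>p\<in>?H \<rightarrow>\<^sub>E UNIV. \<Prod>e\<in>?E. edge_sign \<Gamma> e * (\<Sum>k\<in>UNIV. ?m p e k))"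
  proof (intro sum.cong refl)
    show "(\<Sum>A\<in>Pow ?E. (- 1) ^ card A * (\<Prod>e\<in>?E. ?g p e (e \<in> sym_diff (twisted \<Gamma>) A))) =
        (\<Prod>e\<in>?E. edge_sign \<Gamma> e * (\<Sum>k\<in>UNIV. ?m p e k))" for p
      by (rule trans[OF sum_over_twists[of "?g p"]]) (intro prod.cong refl edge_factor)
  qed
  also have "\<dots> = (\<Sum>p\<in>?H \<rightarrow>\<^sub>E UNIV. (\<Prod>e\<in>?E. edge_sign \<Gamma> e) *
      (\<Sum>\<kappa>\<in>?E \<rightarrow>\<^sub>E UNIV. \<Prod>e\<in>?E. ?m p e (\<kappa> e)))"
    by (simp add: prod.distrib prod_sum_PiE)
  also have "\<dots> = (\<Sum>\<kappa>\<in>?E \<rightarrow>\<^sub>E UNIV. (\<Prod>e\<in>?E. edge_sign \<Gamma> e) *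
      (\<Sum>p\<in>?H \<rightarrow>\<^sub>E UNIV. \<Prod>e\<in>?E. ?m p e (\<kappa> e)))"
    unfolding sum_distrib_left by (rule sum.swap)
  also have "\<dots> = (\<Sum>\<kappa>\<in>?E \<rightarrow>\<^sub>E UNIV.
       (\<Prod>e\<in>?E. edge_sign \<Gamma> e) * (\<Prod>v\<in>verts (graph \<Gamma>). node_sum \<Gamma> \<kappa> v))"
    unfolding sum_over_colours ..
  finally show ?thesis .
qed

end

subsection \<open>Splitting along the boundary of the disc\<close>

text \<open>The inserted point receives the innermost sum, so a set listed in reverse gives nested
  sums in the direct order.\<close>

lemma sum_PiE_insert:
  assumes "i \<notin> S"
  shows "(\<Sum>p\<in>insert i S \<rightarrow>\<^sub>E (UNIV :: 'b set). f p) = (\<Sum>p\<in>S \<rightarrow>\<^sub>E UNIV. \<Sum>x\<in>UNIV. f (p(i := x)))"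
proof -
  have "inj_on (\<lambda>(x, p). p(i := x)) (UNIV \<times> (S \<rightarrow>\<^sub>E (UNIV :: 'b set)))"
    using inj_combinator[OF assms, of "\<lambda>_. UNIV"] .
  then have "(\<Sum>p\<in>insert i S \<rightarrow>\<^sub>E (UNIV :: 'b set). f p) =
      (\<Sum>(x, p)\<in>UNIV \<times> (S \<rightarrow>\<^sub>E UNIV). f (p(i := x)))"
    unfolding PiE_insert_eq by (subst sum.reindex) (simp_all add: case_prod_unfold)
  also have "\<dots> = (\<Sum>x\<in>UNIV. \<Sum>p\<in>S \<rightarrow>\<^sub>E UNIV. f (p(i := x)))"
    by (rule sum.cartesian_product[symmetric])
  finally show ?thesis
    by (simp only: sum.swap[of _ UNIV])
qed

lemma node_sum_clockwise:
  assumes "clockwise_at \<Gamma> v a b c"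
  shows "node_sum \<Gamma> \<kappa> v =
    vertex_weight (\<kappa> (edge_of \<Gamma> a)) (\<kappa> (edge_of \<Gamma> b)) (\<kappa> (edge_of \<Gamma> c))"
proof -
  \<comment> \<open>The order \<open>{c, b, a}\<close> makes the colour at \<open>a\<close> the
    outermost variable, as in \<open>hooft_trace\<close>.\<close>
  from assms have abc: "a \<noteq> b" "a \<noteq> c" "b \<noteq> c" "b \<noteq> a" "c \<noteq> a" "c \<noteq> b"
    and out: "out_arcs (graph \<Gamma>) v = {c, b, a}"
    and rot: "rot \<Gamma> a = b" "rot \<Gamma> b = c" "rot \<Gamma> c = a"
    by (auto simp: clockwise_at_def)
  show ?thesis
    unfolding node_sum_def out hooft_trace[symmetric]
    using abc by (simp add: rot sum_PiE_insert mult_ac)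
qed

lemma clockwise_at_arcs:
  assumes "clockwise_at \<Gamma> v a b c"
  shows "h \<in> arcs (graph \<Gamma>) \<and> tail (graph \<Gamma>) h = v \<longleftrightarrow> h \<in> {a, b, c}"
proof -
  have "h \<in> out_arcs (graph \<Gamma>) v \<longleftrightarrow> h \<in> {a, b, c}"
    using assms by (simp add: clockwise_at_def)
  then show ?thesis by simp
qed

lemma clockwise_atD:
  assumes "clockwise_at \<Gamma> v a b c"
  shows "a \<in> arcs (graph \<Gamma>)" "b \<in> arcs (graph \<Gamma>)" "c \<in> arcs (graph \<Gamma>)"
    and "tail (graph \<Gamma>) a = v" "tail (graph \<Gamma>) b = v" "tail (graph \<Gamma>) c = v"
  using clockwise_at_arcs[OF assms] by blast+

lemma outer_half_edges_eq:
  assumes "\<And>h. h \<in> N \<Longrightarrow> tail (graph \<Gamma>) h \<in> W" "\<And>i. s i \<notin> N"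
    and "\<And>h. h \<in> arcs (graph \<Gamma>) \<Longrightarrow> tail (graph \<Gamma>) h \<in> W \<Longrightarrow> h \<in> range s \<union> N"
  shows "outer_half_edges \<Gamma> W s = arcs (graph \<Gamma>) - N"
  unfolding outer_half_edges_def using assms by blast

definition outer_edges :: "('v, 'h) ribbon_graph \<Rightarrow> 'v set \<Rightarrow> (5 \<Rightarrow> 'h) \<Rightarrow> 'h set set" where
  "outer_edges \<Gamma> W s = edge_of \<Gamma> ` outer_half_edges \<Gamma> W s"

text \<open>The part of a state that lies outside the disc; the signs of the spokes are counted
  here.\<close>

definition outer_weight ::
    "('v, 'h) ribbon_graph \<Rightarrow> 'v set \<Rightarrow> (5 \<Rightarrow> 'h) \<Rightarrow> ('h set \<Rightarrow> hue) \<Rightarrow> rat" where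
  "outer_weight \<Gamma> W s \<kappa> =
     (\<Prod>e\<in>outer_edges \<Gamma> W s. edge_sign \<Gamma> e) * (\<Prod>v\<in>verts (graph \<Gamma>) - W. node_sum \<Gamma> \<kappa> v)"

text \<open>Half-edges at vertices outside \<open>W\<close> lie on outer edges. Hence the outer
  weight can be pulled out of the sums over the hues of inner edges.\<close>

lemma outer_weight_upd:
  assumes "e \<notin> outer_edges \<Gamma> W s"
  shows "outer_weight \<Gamma> W s (\<kappa>(e := x)) = outer_weight \<Gamma> W s \<kappa>"
proof -
  have "node_sum \<Gamma> (\<kappa>(e := x)) v = node_sum \<Gamma> \<kappa> v" if "v \<notin> W" for v
    unfolding node_sum_def
  proof (intro sum.cong prod.cong refl)
    fix p h assume "h \<in> out_arcs (graph \<Gamma>) v"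
    with that have "edge_of \<Gamma> h \<in> outer_edges \<Gamma> W s"
      by (auto simp: outer_edges_def outer_half_edges_def)
    with assms show "hooft ((\<kappa>(e := x)) (edge_of \<Gamma> h)) (p (rot \<Gamma> h)) (p h) =
        hooft (\<kappa> (edge_of \<Gamma> h)) (p (rot \<Gamma> h)) (p h)"
      by auto
  qed
  then show ?thesis
    unfolding outer_weight_def by (intro arg_cong2[where f = "(*)"] prod.cong refl) auto
qed

text \<open>\<open>z\<close> is the tensor of the inside of the disc, fed with the spoke hues
  clockwise from spoke \<open>m\<close>. Configurations with the same outside differ only in
  \<open>z\<close> and \<open>m\<close>.\<close>

definition spoke_sum ::
    "(hue \<Rightarrow> hue \<Rightarrow> hue \<Rightarrow> hue \<Rightarrow> hue \<Rightarrow> rat) \<Rightarrow>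
     ('v, 'h) ribbon_graph \<Rightarrow> 'v set \<Rightarrow> (5 \<Rightarrow> 'h) \<Rightarrow> 5 \<Rightarrow> rat" where
  "spoke_sum z \<Gamma> W s m = (\<Sum>\<kappa>\<in>outer_edges \<Gamma> W s \<rightarrow>\<^sub>E UNIV. outer_weight \<Gamma> W s \<kappa> *
     z (\<kappa> (edge_of \<Gamma> (s m))) (\<kappa> (edge_of \<Gamma> (s (m + 1)))) (\<kappa> (edge_of \<Gamma> (s (m + 2))))
       (\<kappa> (edge_of \<Gamma> (s (m + 3)))) (\<kappa> (edge_of \<Gamma> (s (m + 4)))))"

context full_ribbon_graph
begin

text \<open>\<open>N\<close> consists of the half-edges of the inner edges. It is closed under
  \<open>opp\<close>, so no edge is both inner and outer; inner edges are untwisted, so each has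
  sign -1/2.\<close>

lemma bracket_split:
  assumes W: "W \<subseteq> verts (graph \<Gamma>)"
    and outer: "outer_half_edges \<Gamma> W s = arcs (graph \<Gamma>) - N"
    and N: "N \<subseteq> arcs (graph \<Gamma>)" "\<And>h. h \<in> N \<Longrightarrow> opp \<Gamma> h \<in> N"
    and untwisted: "\<And>h. h \<in> N \<Longrightarrow> edge_of \<Gamma> h \<notin> twisted \<Gamma>"
  shows "edge_of \<Gamma> ` N \<inter> outer_edges \<Gamma> W s = {}"
    and "penrose_bracket \<Gamma> 4 =
      (\<Sum>\<kappa>\<in>(edge_of \<Gamma> ` N \<union> outer_edges \<Gamma> W s) \<rightarrow>\<^sub>E UNIV. outer_weight \<Gamma> W s \<kappa> *
         ((- (1 / 2)) ^ card (edge_of \<Gamma> ` N) * (\<Prod>v\<in>W. node_sum \<Gamma> \<kappa> v)))"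
proof -
  show disj: "edge_of \<Gamma> ` N \<inter> outer_edges \<Gamma> W s = {}"
  proof (rule ccontr)
    assume "\<not> ?thesis"
    then obtain h h' where h: "h \<in> N" "h' \<in> arcs (graph \<Gamma>)" "h' \<notin> N" "edge_of \<Gamma> h = edge_of \<Gamma> h'"
      by (auto simp: outer_edges_def outer)
    then have "h' \<in> {h, opp \<Gamma> h}" by (auto simp: edge_of_def)
    with h N(2) show False by auto
  qed
  have edges: "edges \<Gamma> = edge_of \<Gamma> ` N \<union> outer_edges \<Gamma> W s"
    unfolding edges_def outer_edges_def outer using N(1) by blast
  have fin: "finite (edge_of \<Gamma> ` N)" "finite (outer_edges \<Gamma> W s)" "finite W"
    using finite_edges W finite_subset[OF _ finite_verts] unfolding edges by auto
  have "(\<Prod>e\<in>edge_of \<Gamma> ` N. edge_sign \<Gamma> e) = (\<Prod>e\<in>edge_of \<Gamma> ` N. - (1 / 2))"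
    using untwisted by (intro prod.cong) (auto simp: edge_sign_def)
  then have sign: "(\<Prod>e\<in>edges \<Gamma>. edge_sign \<Gamma> e) =
      (- (1 / 2)) ^ card (edge_of \<Gamma> ` N) * (\<Prod>e\<in>outer_edges \<Gamma> W s. edge_sign \<Gamma> e)"
    unfolding edges using fin disj by (subst prod.union_disjoint) simp_all
  have "(\<Prod>v\<in>verts (graph \<Gamma>). node_sum \<Gamma> \<kappa> v) =
      (\<Prod>v\<in>verts (graph \<Gamma>) - W. node_sum \<Gamma> \<kappa> v) * (\<Prod>v\<in>W. node_sum \<Gamma> \<kappa> v)" for \<kappa>
    using W by (rule prod.subset_diff) simp
  then show "penrose_bracket \<Gamma> 4 =
      (\<Sum>\<kappa>\<in>(edge_of \<Gamma> ` N \<union> outer_edges \<Gamma> W s) \<rightarrow>\<^sub>E UNIV. outer_weight \<Gamma> W s \<kappa> *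
         ((- (1 / 2)) ^ card (edge_of \<Gamma> ` N) * (\<Prod>v\<in>W. node_sum \<Gamma> \<kappa> v)))"
    unfolding penrose_state_sum sign outer_weight_def
    unfolding edges by (simp add: mult_ac)
qed

lemma edge_of_eq_iff:
  "h \<in> arcs (graph \<Gamma>) \<Longrightarrow> edge_of \<Gamma> h = edge_of \<Gamma> h' \<longleftrightarrow> h' = h \<or> h' = opp \<Gamma> h"
  by (auto simp: edge_of_def opp_opp doubleton_eq_iff)

end

lemma UNIV_5: "(UNIV :: 5 set) = {1, 2, 3, 4, 5}"
  by (rule sym, rule card_subset_eq) simp_all

lemma UNIV_5_shift: "(UNIV :: 5 set) = {m, m + 1, m + 2, m + 3, m + 4}"
  by (rule sym, rule card_subset_eq) simp_all

lemma UNIV_4: "(UNIV :: 4 set) = {1, 2, 3, 4}"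
  by (rule sym, rule card_subset_eq) simp_all

lemma prod_5: "(\<Prod>i\<in>UNIV. f i) = f 1 * (f 2 * (f 3 * (f 4 * f 5)))" for f :: "5 \<Rightarrow> rat"
  unfolding UNIV_5 by simp

lemma prod_4: "(\<Prod>i\<in>UNIV. f i) = f 1 * (f 2 * (f 3 * f 4))" for f :: "4 \<Rightarrow> rat"
  unfolding UNIV_4 by simp

section \<open>Brackets of graphs containing the pentagon, the quadrilateral or a tree\<close>

context full_ribbon_graph
begin

text \<open>The inner edges are the five sides. Once they are known to be distinct from each other
  and from the spokes, summing over their hues produces \<open>pentagon_weight\<close>.\<close>

lemma pentagon_bracket:
  assumes "pentagon_config \<Gamma> W s"
  shows "penrose_bracket \<Gamma> 4 = spoke_sum pentagon_weight \<Gamma> W s 1"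
proof -
  from assms obtain v c where v: "inj v" and W: "W = range v"
    and cw: "\<And>i. clockwise_at \<Gamma> (v i) (s i) (c i) (opp \<Gamma> (c (i - 1)))"
    and untwisted: "\<And>i. edge_of \<Gamma> (c i) \<notin> twisted \<Gamma>"
    unfolding pentagon_config_def polygonal_face_def by blast
  let ?N = "range c \<union> opp \<Gamma> ` range c"
  note arcs = clockwise_at_arcs[OF cw]
  have c: "c i \<in> arcs (graph \<Gamma>)" "tail (graph \<Gamma>) (c i) = v i"
    and s: "s i \<in> arcs (graph \<Gamma>)" "tail (graph \<Gamma>) (s i) = v i"
    and c': "opp \<Gamma> (c i) \<in> arcs (graph \<Gamma>)" "tail (graph \<Gamma>) (opp \<Gamma> (c i)) = v (i + 1)" for i
    using arcs[of "c i" i] arcs[of "s i" i] arcs[of "opp \<Gamma> (c i)" "i + 1"] by simp_all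
  have neq: "s i \<noteq> c i" "s i \<noteq> opp \<Gamma> (c (i - 1))" "c i \<noteq> opp \<Gamma> (c (i - 1))" for i
    using cw[of i] by (simp_all add: clockwise_at_def)
  \<comment> \<open>A coincidence would put both half-edges at the same vertex, by injectivity of
    \<open>v\<close>, where \<open>clockwise_at\<close> makes them distinct.\<close>
  have sN: "s i \<notin> ?N" for i
  proof
    assume "s i \<in> ?N"
    then obtain j where "s i = c j \<or> s i = opp \<Gamma> (c j)" by blast
    then show False
    proof
      assume eq: "s i = c j"
      then have "v i = v j" using s(2) c(2) by metis
      with v eq neq(1)[of j] show False by (simp add: inj_eq)
    next
      assume eq: "s i = opp \<Gamma> (c j)"
      then have "v i = v (j + 1)" using s(2) c'(2) by metis
      with v eq neq(2)[of "j + 1"] show False by (simp add: inj_eq)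
    qed
  qed
  have outer: "outer_half_edges \<Gamma> W s = arcs (graph \<Gamma>) - ?N"
  proof (rule outer_half_edges_eq)
    show "tail (graph \<Gamma>) h \<in> W" if "h \<in> ?N" for h
      using that c(2) c'(2) by (auto simp: W)
    show "h \<in> range s \<union> ?N" if "h \<in> arcs (graph \<Gamma>)" "tail (graph \<Gamma>) h \<in> W" for h
    proof -
      from that(2) obtain i where "tail (graph \<Gamma>) h = v i" by (auto simp: W)
      then show ?thesis using that(1) arcs[of h i] by auto
    qed
  qed (rule sN)
  define S E where "S i = edge_of \<Gamma> (s i)" and "E i = edge_of \<Gamma> (c i)" for i
  have E': "edge_of \<Gamma> (opp \<Gamma> (c i)) = E i" for i
    using c(1) by (simp add: E_def edge_of_opp)
  \<comment> \<open>The reversed order makes the nested sums run over \<open>E 1\<close> to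
    \<open>E 5\<close>, as \<open>l1\<close> to \<open>l5\<close> do in
    \<open>pentagon_weight\<close>.\<close>
  have EN: "edge_of \<Gamma> ` ?N = {E 5, E 4, E 3, E 2, E 1}"
    using E' by (auto simp: image_Un image_image UNIV_5 E_def[symmetric])
  \<comment> \<open>If a side were the reverse of another, the tails would give
    \<open>j = i + 1\<close>, but \<open>c (i + 1)\<close> and \<open>opp \<Gamma> (c i)\<close> are
    distinct half-edges at \<open>v (i + 1)\<close>.\<close>
  have "inj E"
  proof (rule injI)
    fix i j assume "E i = E j"
    then have "c j = c i \<or> c j = opp \<Gamma> (c i)"
      using edge_of_eq_iff[OF c(1)] by (simp add: E_def)
    then show "i = j"
    proof
      assume "c j = c i"
      then have "v i = v j" using c(2) by metis
      with v show ?thesis by (simp add: inj_eq)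
    next
      assume eq: "c j = opp \<Gamma> (c i)"
      then have "v j = v (i + 1)" using c(2) c'(2) by metis
      with v eq neq(3)[of "i + 1"] show ?thesis by (simp add: inj_eq)
    qed
  qed
  note E_eq [simp] = inj_eq[OF this]
  have node: "node_sum \<Gamma> \<kappa> (v i) = vertex_weight (\<kappa> (S i)) (\<kappa> (E i)) (\<kappa> (E (i - 1)))" for \<kappa> i
    using node_sum_clockwise[OF cw] by (simp add: E' S_def E_def[symmetric])
  \<comment> \<open>The incoming side at \<open>v 1\<close> is \<open>c 0\<close>, and 0 = 5 in the
    index type.\<close>
  have E0: "E 0 = E 5"
    by (rule arg_cong[where f = E]) simp
  have W_prod: "(\<Prod>v\<in>W. node_sum \<Gamma> \<kappa> v) =
      vertex_weight (\<kappa> (S 1)) (\<kappa> (E 1)) (\<kappa> (E 5)) * (vertex_weight (\<kappa> (S 2)) (\<kappa> (E 2)) (\<kappa> (E 1)) *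
      (vertex_weight (\<kappa> (S 3)) (\<kappa> (E 3)) (\<kappa> (E 2)) * (vertex_weight (\<kappa> (S 4)) (\<kappa> (E 4)) (\<kappa> (E 3)) *
      vertex_weight (\<kappa> (S 5)) (\<kappa> (E 5)) (\<kappa> (E 4)))))" for \<kappa>
  proof -
    have "(\<Prod>v\<in>W. node_sum \<Gamma> \<kappa> v) = (\<Prod>i\<in>UNIV. node_sum \<Gamma> \<kappa> (v i))"
      unfolding W by (simp add: prod.reindex[OF v])
    then show ?thesis
      by (simp add: node prod_5 E0)
  qed
  have "W \<subseteq> verts (graph \<Gamma>)"
    using cw by (auto simp: W clockwise_at_def)
  moreover have "opp \<Gamma> h \<in> ?N" if "h \<in> ?N" for h
    using that c(1) opp_opp by auto
  moreover have "edge_of \<Gamma> h \<notin> twisted \<Gamma>" if "h \<in> ?N" for h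
    using that untwisted E' by (auto simp: E_def)
  moreover have "?N \<subseteq> arcs (graph \<Gamma>)"
    using c(1) c'(1) by auto
  ultimately have split: "{E 5, E 4, E 3, E 2, E 1} \<inter> outer_edges \<Gamma> W s = {}"
      "penrose_bracket \<Gamma> 4 =
        (\<Sum>\<kappa>\<in>({E 5, E 4, E 3, E 2, E 1} \<union> outer_edges \<Gamma> W s) \<rightarrow>\<^sub>E UNIV. outer_weight \<Gamma> W s \<kappa> *
         ((- (1 / 2)) ^ card {E 5, E 4, E 3, E 2, E 1} * (\<Prod>v\<in>W. node_sum \<Gamma> \<kappa> v)))"
    using bracket_split[OF _ outer] unfolding EN by blast+
  have "S i \<in> outer_edges \<Gamma> W s" for i
    using s(1) sN by (auto simp: S_def outer_edges_def outer)
  with split(1) have SE: "S i \<noteq> E 1" "S i \<noteq> E 2" "S i \<noteq> E 3" "S i \<noteq> E 4" "S i \<noteq> E 5" for i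
    by (metis disjoint_iff insertI1 insertI2)+
  show ?thesis
    unfolding split(2) W_prod spoke_sum_def pentagon_weight_def S_def[symmetric] Un_insert_left Un_empty_left
    using split(1) by (simp add: sum_PiE_insert outer_weight_upd SE sum_distrib_left power_divide)
qed

text \<open>There are again five inner edges: the four sides and \<open>f\<close>, whose half at the
  quadrilateral is \<open>t 4\<close>.\<close>

lemma quadrilateral_bracket:
  assumes "Q_config \<Gamma> W s"
  shows "penrose_bracket \<Gamma> 4 = spoke_sum quadrilateral_weight \<Gamma> W s 1"
proof -
  from assms obtain v :: "4 \<Rightarrow> 'v" and t w c where v: "inj v" and W: "W = insert w (range v)"
    and t: "t 1 = s 1" "t 2 = s 2" "t 3 = s 3"
    and w: "w \<notin> range v" and cw_w: "clockwise_at \<Gamma> w (s 4) (s 5) (opp \<Gamma> (t 4))"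
    and cw: "\<And>i. clockwise_at \<Gamma> (v i) (t i) (c i) (opp \<Gamma> (c (i - 1)))"
    and untwisted: "\<And>i. edge_of \<Gamma> (c i) \<notin> twisted \<Gamma>" "edge_of \<Gamma> (t 4) \<notin> twisted \<Gamma>"
    unfolding Q_config_def polygonal_face_def by blast
  let ?N = "range c \<union> opp \<Gamma> ` range c \<union> {t 4, opp \<Gamma> (t 4)}"
  note arcs = clockwise_at_arcs[OF cw] and arcs_w = clockwise_at_arcs[OF cw_w]
  have c: "c i \<in> arcs (graph \<Gamma>)" "tail (graph \<Gamma>) (c i) = v i"
    and t_v: "t i \<in> arcs (graph \<Gamma>)" "tail (graph \<Gamma>) (t i) = v i"
    and c': "opp \<Gamma> (c i) \<in> arcs (graph \<Gamma>)" "tail (graph \<Gamma>) (opp \<Gamma> (c i)) = v (i + 1)" for i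
    using arcs[of "c i" i] arcs[of "t i" i] arcs[of "opp \<Gamma> (c i)" "i + 1"] by simp_all
  have s_w: "s 4 \<in> arcs (graph \<Gamma>)" "tail (graph \<Gamma>) (s 4) = w"
      "s 5 \<in> arcs (graph \<Gamma>)" "tail (graph \<Gamma>) (s 5) = w"
    and f: "opp \<Gamma> (t 4) \<in> arcs (graph \<Gamma>)" "tail (graph \<Gamma>) (opp \<Gamma> (t 4)) = w"
    using clockwise_atD[OF cw_w] by simp_all
  have neq: "t i \<noteq> c i" "t i \<noteq> opp \<Gamma> (c (i - 1))" "c i \<noteq> opp \<Gamma> (c (i - 1))" for i
    using cw[of i] by (simp_all add: clockwise_at_def)
  have neq_w: "s 4 \<noteq> opp \<Gamma> (t 4)" "s 5 \<noteq> opp \<Gamma> (t 4)"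
    using cw_w by (simp_all add: clockwise_at_def)
  have w_v: "w \<noteq> v i" "v i \<noteq> w" for i
    using w by auto
  have t_c: "t i \<noteq> c j" "t i \<noteq> opp \<Gamma> (c j)" for i j
  proof
    assume eq: "t i = c j"
    then have "v i = v j" using t_v(2) c(2) by metis
    with v eq neq(1)[of j] show False by (simp add: inj_eq)
  next
    show "t i \<noteq> opp \<Gamma> (c j)"
    proof
      assume eq: "t i = opp \<Gamma> (c j)"
      then have "v i = v (j + 1)" using t_v(2) c'(2) by metis
      with v eq neq(2)[of "j + 1"] show False by (simp add: inj_eq)
    qed
  qed
  have tN: "t i \<notin> ?N" if "i \<noteq> 4" for i
  proof -
    have "t i \<noteq> t 4" using that v t_v(2) by (metis inj_eq)
    moreover have "t i \<noteq> opp \<Gamma> (t 4)" using t_v(2) f(2) w_v by metis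
    ultimately show ?thesis using t_c by auto
  qed
  \<comment> \<open>\<open>opp \<Gamma> (t 4)\<close> is the only inner half-edge at
    \<open>w\<close>, so \<open>s 4\<close> and \<open>s 5\<close> are not inner.\<close>
  have "tail (graph \<Gamma>) h \<in> range v" if "h \<in> ?N" "h \<noteq> opp \<Gamma> (t 4)" for h
    using that c(2) c'(2) t_v(2) by auto
  then have wN: "s 4 \<notin> ?N" "s 5 \<notin> ?N"
    using s_w(2,4) neq_w w by metis+
  have s_cases: "range s = {t 1, t 2, t 3, s 4, s 5}"
    by (auto simp: UNIV_5 t)
  have sN: "s i \<notin> ?N" for i
  proof -
    have "s i \<in> {t 1, t 2, t 3, s 4, s 5}" using s_cases by blast
    moreover have "t 1 \<notin> ?N" "t 2 \<notin> ?N" "t 3 \<notin> ?N" by (rule tN; simp)+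
    ultimately show ?thesis using wN by (elim insertE emptyE) (simp_all only: not_False_eq_True)
  qed
  have s: "s i \<in> arcs (graph \<Gamma>)" for i
  proof -
    have "s i \<in> {t 1, t 2, t 3, s 4, s 5}" using s_cases by blast
    then show ?thesis using t_v(1) s_w by auto
  qed
  have t_cases: "t i \<in> range s \<or> t i = t 4" for i
  proof -
    have "i \<in> {1, 2, 3, 4}" using UNIV_4 by blast
    then show ?thesis unfolding s_cases by auto
  qed
  have outer: "outer_half_edges \<Gamma> W s = arcs (graph \<Gamma>) - ?N"
  proof (rule outer_half_edges_eq)
    show "tail (graph \<Gamma>) h \<in> W" if "h \<in> ?N" for h
      using that c(2) c'(2) t_v(2) f(2) by (auto simp: W)
    fix h assume h: "h \<in> arcs (graph \<Gamma>)" "tail (graph \<Gamma>) h \<in> W"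
    from h(2) consider "tail (graph \<Gamma>) h = w" | i where "tail (graph \<Gamma>) h = v i"
      by (auto simp: W)
    then show "h \<in> range s \<union> ?N"
    proof cases
      case 1
      then show ?thesis using arcs_w[of h] h(1) by auto
    next
      case 2
      then show ?thesis using arcs[of h i] h(1) t_cases[of i] by auto
    qed
  qed (rule sN)
  define S E F where "S i = edge_of \<Gamma> (s i)" and "E j = edge_of \<Gamma> (c j)"
    and "F = edge_of \<Gamma> (t 4)" for i j
  have E': "edge_of \<Gamma> (opp \<Gamma> (c i)) = E i" "edge_of \<Gamma> (opp \<Gamma> (t 4)) = F" for i
    using c(1) t_v(1) by (simp_all add: E_def F_def edge_of_opp)
  have EN: "edge_of \<Gamma> ` ?N = {E 4, E 3, E 2, E 1, F}"
    using E' by (auto simp: image_Un image_image UNIV_4 E_def[symmetric] F_def[symmetric])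
  have "inj E"
  proof (rule injI)
    fix i j assume "E i = E j"
    then have "c j = c i \<or> c j = opp \<Gamma> (c i)"
      using edge_of_eq_iff[OF c(1)] by (simp add: E_def)
    then show "i = j"
    proof
      assume "c j = c i"
      then have "v i = v j" using c(2) by metis
      with v show ?thesis by (simp add: inj_eq)
    next
      assume eq: "c j = opp \<Gamma> (c i)"
      then have "v j = v (i + 1)" using c(2) c'(2) by metis
      with v eq neq(3)[of "i + 1"] show ?thesis by (simp add: inj_eq)
    qed
  qed
  note E_eq [simp] = inj_eq[OF this]
  have F_E [simp]: "F \<noteq> E i" "E i \<noteq> F" for i
    using edge_of_eq_iff[OF c(1), of i "t 4"] t_c[of 4 i] by (auto simp: E_def F_def)
  have node: "node_sum \<Gamma> \<kappa> (v i) = vertex_weight (\<kappa> (edge_of \<Gamma> (t i))) (\<kappa> (E i)) (\<kappa> (E (i - 1)))"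
    and node_w: "node_sum \<Gamma> \<kappa> w = vertex_weight (\<kappa> (S 4)) (\<kappa> (S 5)) (\<kappa> F)" for \<kappa> i
    using node_sum_clockwise[OF cw] node_sum_clockwise[OF cw_w]
    by (simp_all add: E' S_def E_def[symmetric])
  have E0: "E 0 = E 4"
    by (rule arg_cong[where f = E]) simp
  have tS: "edge_of \<Gamma> (t 1) = S 1" "edge_of \<Gamma> (t 2) = S 2" "edge_of \<Gamma> (t 3) = S 3"
    "edge_of \<Gamma> (t 4) = F"
    by (simp_all add: t S_def F_def)
  have W_prod: "(\<Prod>v\<in>W. node_sum \<Gamma> \<kappa> v) =
      vertex_weight (\<kappa> (S 1)) (\<kappa> (E 1)) (\<kappa> (E 4)) * (vertex_weight (\<kappa> (S 2)) (\<kappa> (E 2)) (\<kappa> (E 1)) *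
      (vertex_weight (\<kappa> (S 3)) (\<kappa> (E 3)) (\<kappa> (E 2)) * (vertex_weight (\<kappa> F) (\<kappa> (E 4)) (\<kappa> (E 3)) *
      vertex_weight (\<kappa> (S 4)) (\<kappa> (S 5)) (\<kappa> F))))" for \<kappa>
  proof -
    have "(\<Prod>v\<in>W. node_sum \<Gamma> \<kappa> v) = node_sum \<Gamma> \<kappa> w * (\<Prod>i\<in>UNIV. node_sum \<Gamma> \<kappa> (v i))"
      unfolding W using w by (simp add: prod.reindex[OF v])
    then show ?thesis
      by (simp add: node node_w prod_4 E0 tS)
  qed
  have "W \<subseteq> verts (graph \<Gamma>)"
    using cw cw_w by (auto simp: W clockwise_at_def)
  moreover have "opp \<Gamma> h \<in> ?N" if "h \<in> ?N" for h
    using that c(1) t_v(1) opp_opp by auto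
  moreover have "edge_of \<Gamma> h \<notin> twisted \<Gamma>" if "h \<in> ?N" for h
    using that untwisted E' by (auto simp: E_def F_def)
  moreover have "?N \<subseteq> arcs (graph \<Gamma>)"
    using c(1) c'(1) t_v(1) f(1) by auto
  ultimately have split: "{E 4, E 3, E 2, E 1, F} \<inter> outer_edges \<Gamma> W s = {}"
      "penrose_bracket \<Gamma> 4 =
        (\<Sum>\<kappa>\<in>({E 4, E 3, E 2, E 1, F} \<union> outer_edges \<Gamma> W s) \<rightarrow>\<^sub>E UNIV. outer_weight \<Gamma> W s \<kappa> *
         ((- (1 / 2)) ^ card {E 4, E 3, E 2, E 1, F} * (\<Prod>v\<in>W. node_sum \<Gamma> \<kappa> v)))"
    using bracket_split[OF _ outer] unfolding EN by blast+
  have "S i \<in> outer_edges \<Gamma> W s" for i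
    using s sN by (auto simp: S_def outer_edges_def outer)
  with split(1) have SE: "S i \<noteq> E 1" "S i \<noteq> E 2" "S i \<noteq> E 3" "S i \<noteq> E 4" "S i \<noteq> F" for i
    by (metis disjoint_iff insertI1 insertI2)+
  show ?thesis
    unfolding split(2) W_prod spoke_sum_def quadrilateral_weight_def S_def[symmetric]
      Un_insert_left Un_empty_left
    using split(1) by (simp add: sum_PiE_insert outer_weight_upd SE sum_distrib_left power_divide)
qed

text \<open>The two inner edges are \<open>f\<close> and \<open>g\<close>; reading the spokes from
  \<open>m\<close> on treats all five trees at once.\<close>

lemma tree_bracket:
  assumes "T_config m \<Gamma> W s"
  shows "penrose_bracket \<Gamma> 4 = spoke_sum tree_weight \<Gamma> W s m"
proof -
  from assms obtain x y z f g where xyz: "distinct [x, y, z]" and W: "W = {x, y, z}"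
    and cw: "clockwise_at \<Gamma> x (s m) f g"
      "clockwise_at \<Gamma> y (s (m + 1)) (s (m + 2)) (opp \<Gamma> f)"
      "clockwise_at \<Gamma> z (s (m + 3)) (s (m + 4)) (opp \<Gamma> g)"
    and untwisted: "edge_of \<Gamma> f \<notin> twisted \<Gamma>" "edge_of \<Gamma> g \<notin> twisted \<Gamma>"
    unfolding T_config_def by blast
  let ?N = "{f, opp \<Gamma> f, g, opp \<Gamma> g}"
  note arcs = cw[THEN clockwise_at_arcs]
  have in_arcs: "s m \<in> arcs (graph \<Gamma>)" "s (m + 1) \<in> arcs (graph \<Gamma>)" "s (m + 2) \<in> arcs (graph \<Gamma>)"
      "s (m + 3) \<in> arcs (graph \<Gamma>)" "s (m + 4) \<in> arcs (graph \<Gamma>)" "f \<in> arcs (graph \<Gamma>)"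
      "g \<in> arcs (graph \<Gamma>)" "opp \<Gamma> f \<in> arcs (graph \<Gamma>)" "opp \<Gamma> g \<in> arcs (graph \<Gamma>)"
    and tails: "tail (graph \<Gamma>) (s m) = x" "tail (graph \<Gamma>) f = x" "tail (graph \<Gamma>) g = x"
      "tail (graph \<Gamma>) (s (m + 1)) = y" "tail (graph \<Gamma>) (s (m + 2)) = y"
      "tail (graph \<Gamma>) (opp \<Gamma> f) = y"
      "tail (graph \<Gamma>) (s (m + 3)) = z" "tail (graph \<Gamma>) (s (m + 4)) = z"
      "tail (graph \<Gamma>) (opp \<Gamma> g) = z"
    using cw[THEN clockwise_atD(1)] cw[THEN clockwise_atD(2)] cw[THEN clockwise_atD(3)]
      cw[THEN clockwise_atD(4)] cw[THEN clockwise_atD(5)] cw[THEN clockwise_atD(6)] by simp_all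
  have neq: "s m \<noteq> f" "s m \<noteq> g" "f \<noteq> g" "s (m + 1) \<noteq> opp \<Gamma> f" "s (m + 2) \<noteq> opp \<Gamma> f"
    "s (m + 3) \<noteq> opp \<Gamma> g" "s (m + 4) \<noteq> opp \<Gamma> g"
    using cw by (simp_all add: clockwise_at_def)
  have s_cases: "range s = {s m, s (m + 1), s (m + 2), s (m + 3), s (m + 4)}"
  proof -
    have "range s = s ` {m, m + 1, m + 2, m + 3, m + 4}"
      by (rule arg_cong[OF UNIV_5_shift])
    then show ?thesis by simp
  qed
  \<comment> \<open>Half-edges at different vertices are separated by their tails, those at the same
    vertex by \<open>clockwise_at\<close>.\<close>
  have "{s m, s (m + 1), s (m + 2), s (m + 3), s (m + 4)} \<inter> ?N = {}"
  proof -
    have "s m \<noteq> opp \<Gamma> f" "s m \<noteq> opp \<Gamma> g" "s (m + 1) \<noteq> f" "s (m + 1) \<noteq> g" "s (m + 1) \<noteq> opp \<Gamma> g"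
      "s (m + 2) \<noteq> f" "s (m + 2) \<noteq> g" "s (m + 2) \<noteq> opp \<Gamma> g" "s (m + 3) \<noteq> f" "s (m + 3) \<noteq> g"
      "s (m + 3) \<noteq> opp \<Gamma> f" "s (m + 4) \<noteq> f" "s (m + 4) \<noteq> g" "s (m + 4) \<noteq> opp \<Gamma> f"
      using tails xyz by auto
    with neq show ?thesis by blast
  qed
  then have sN: "s i \<notin> ?N" for i
    using s_cases by blast
  have outer: "outer_half_edges \<Gamma> W s = arcs (graph \<Gamma>) - ?N"
  proof (rule outer_half_edges_eq)
    show "tail (graph \<Gamma>) h \<in> W" if "h \<in> ?N" for h
      using that tails by (auto simp: W)
    show "h \<in> range s \<union> ?N" if "h \<in> arcs (graph \<Gamma>)" "tail (graph \<Gamma>) h \<in> W" for h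
      using that arcs[of h] unfolding W s_cases by blast
  qed (rule sN)
  define S F G where "S i = edge_of \<Gamma> (s i)" and "F = edge_of \<Gamma> f" and "G = edge_of \<Gamma> g" for i
  have FG: "edge_of \<Gamma> (opp \<Gamma> f) = F" "edge_of \<Gamma> (opp \<Gamma> g) = G"
    using in_arcs by (simp_all add: F_def G_def edge_of_opp)
  have EN: "edge_of \<Gamma> ` ?N = {G, F}"
    using FG by (auto simp: F_def[symmetric] G_def[symmetric])
  have "g \<noteq> opp \<Gamma> f"
    using tails xyz by auto
  then have F_G [simp]: "F \<noteq> G" "G \<noteq> F"
    using edge_of_eq_iff[OF in_arcs(6), of g] neq by (auto simp: F_def G_def)
  have W_prod: "(\<Prod>v\<in>W. node_sum \<Gamma> \<kappa> v) = vertex_weight (\<kappa> (S m)) (\<kappa> F) (\<kappa> G) *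
      (vertex_weight (\<kappa> (S (m + 1))) (\<kappa> (S (m + 2))) (\<kappa> F) *
       vertex_weight (\<kappa> (S (m + 3))) (\<kappa> (S (m + 4))) (\<kappa> G))" for \<kappa>
    unfolding W using xyz cw[THEN node_sum_clockwise]
    by (simp add: FG S_def F_def[symmetric] G_def[symmetric])
  have "W \<subseteq> verts (graph \<Gamma>)"
    using cw by (auto simp: W clockwise_at_def)
  moreover have "opp \<Gamma> h \<in> ?N" if "h \<in> ?N" for h
    using that in_arcs opp_opp by auto
  moreover have "edge_of \<Gamma> h \<notin> twisted \<Gamma>" if "h \<in> ?N" for h
    using that untwisted FG by (auto simp: F_def G_def)
  moreover have "?N \<subseteq> arcs (graph \<Gamma>)"
    using in_arcs by auto
  ultimately have split: "{G, F} \<inter> outer_edges \<Gamma> W s = {}"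
      "penrose_bracket \<Gamma> 4 =
        (\<Sum>\<kappa>\<in>({G, F} \<union> outer_edges \<Gamma> W s) \<rightarrow>\<^sub>E UNIV. outer_weight \<Gamma> W s \<kappa> *
         ((- (1 / 2)) ^ card {G, F} * (\<Prod>v\<in>W. node_sum \<Gamma> \<kappa> v)))"
    using bracket_split[OF _ outer] unfolding EN by blast+
  have "range s \<subseteq> arcs (graph \<Gamma>)"
    unfolding s_cases using in_arcs by auto
  then have "S i \<in> outer_edges \<Gamma> W s" for i
    using sN by (auto simp: S_def outer_edges_def outer)
  with split(1) have SE: "S i \<noteq> F" "S i \<noteq> G" for i
    by (metis disjoint_iff insertI1 insertI2)+
  show ?thesis
    unfolding split(2) W_prod spoke_sum_def tree_weight_def S_def[symmetric]
      Un_insert_left Un_empty_left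
    using split(1) by (simp add: sum_PiE_insert outer_weight_upd SE sum_distrib_left power_divide)
qed

end

subsection \<open>Replacement\<close>

text \<open>What the comparison of two outsides needs to know about a configuration. The last clause
  ensures that a replacement creates no bare disc.\<close>

definition spokes_at :: "('v, 'h) ribbon_graph \<Rightarrow> 'v set \<Rightarrow> (5 \<Rightarrow> 'h) \<Rightarrow> bool" where
  "spokes_at \<Gamma> W s \<longleftrightarrow>
     (\<forall>i. s i \<in> arcs (graph \<Gamma>) \<and> tail (graph \<Gamma>) (s i) \<in> W) \<and>
     (\<forall>v\<in>W. out_arcs (graph \<Gamma>) v \<noteq> {})"

lemma spokes_at_pentagon:
  assumes "pentagon_config \<Gamma> W s"
  shows "spokes_at \<Gamma> W s"
proof -
  from assms obtain v c where "W = range v"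
    and cw: "\<And>i. clockwise_at \<Gamma> (v i) (s i) (c i) (opp \<Gamma> (c (i - 1)))"
    unfolding pentagon_config_def polygonal_face_def by blast
  then show ?thesis
    using cw[THEN clockwise_atD(1)] cw[THEN clockwise_atD(4)]
    by (auto simp: spokes_at_def out_arcs_def)
qed

lemma spokes_at_quadrilateral:
  fixes \<Gamma> :: "('v, 'h) ribbon_graph"
  assumes "Q_config \<Gamma> W s"
  shows "spokes_at \<Gamma> W s"
proof -
  from assms obtain v :: "4 \<Rightarrow> 'v" and t w c where W: "W = insert w (range v)"
    and t: "t 1 = s 1" "t 2 = s 2" "t 3 = s 3"
    and cw_w: "clockwise_at \<Gamma> w (s 4) (s 5) (opp \<Gamma> (t 4))"
    and cw: "\<And>i. clockwise_at \<Gamma> (v i) (t i) (c i) (opp \<Gamma> (c (i - 1)))"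
    unfolding Q_config_def polygonal_face_def by blast
  note arcs = cw[THEN clockwise_atD(1)] and tails = cw[THEN clockwise_atD(4)]
  have "s i \<in> arcs (graph \<Gamma>) \<and> tail (graph \<Gamma>) (s i) \<in> W" for i
  proof -
    have "i \<in> {1, 2, 3, 4, 5}" using UNIV_5 by blast
    then show ?thesis
      using arcs[of 1] arcs[of 2] arcs[of 3] tails[of 1] tails[of 2] tails[of 3]
        clockwise_atD[OF cw_w]
      by (auto simp: W t)
  qed
  moreover have "out_arcs (graph \<Gamma>) u \<noteq> {}" if "u \<in> W" for u
    using that arcs tails clockwise_atD(1,4)[OF cw_w] by (auto simp: W out_arcs_def)
  ultimately show ?thesis
    by (simp add: spokes_at_def)
qed

lemma spokes_at_tree:
  assumes "T_config m \<Gamma> W s"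
  shows "spokes_at \<Gamma> W s"
proof -
  from assms obtain x y z f g where W: "W = {x, y, z}"
    and cw: "clockwise_at \<Gamma> x (s m) f g"
      "clockwise_at \<Gamma> y (s (m + 1)) (s (m + 2)) (opp \<Gamma> f)"
      "clockwise_at \<Gamma> z (s (m + 3)) (s (m + 4)) (opp \<Gamma> g)"
    unfolding T_config_def by blast
  note D = clockwise_atD[OF cw(1)] clockwise_atD[OF cw(2)] clockwise_atD[OF cw(3)]
  have "s i \<in> arcs (graph \<Gamma>) \<and> tail (graph \<Gamma>) (s i) \<in> W" for i
  proof -
    have "i \<in> {m, m + 1, m + 2, m + 3, m + 4}" using UNIV_5_shift by blast
    then show ?thesis
      using D by (elim insertE emptyE) (simp_all add: W)
  qed
  moreover have "out_arcs (graph \<Gamma>) u \<noteq> {}" if "u \<in> W" for u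
    using that D by (auto simp: W out_arcs_def)
  ultimately show ?thesis
    by (simp add: spokes_at_def)
qed

context
  fixes s :: "5 \<Rightarrow> 'h" and \<Gamma> \<Gamma>' :: "('v, 'h) ribbon_graph" and W W' :: "'v set"
  assumes same: "same_outside s \<Gamma> W \<Gamma>' W'"
    and spokes: "spokes_at \<Gamma> W s" "spokes_at \<Gamma>' W' s"
begin

lemma outer_half_edges_same: "outer_half_edges \<Gamma>' W' s = outer_half_edges \<Gamma> W s"
  using same by (simp add: same_outside_def)

lemma edge_of_same: "h \<in> outer_half_edges \<Gamma> W s \<Longrightarrow> edge_of \<Gamma>' h = edge_of \<Gamma> h"
  using same by (simp add: same_outside_def edge_of_def)

text \<open>All spoke ends sit inside the disc. The half-edges at an outside vertex are therefore
  outer and not spoke ends, and for those \<open>same_outside\<close> fixes tail and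
  rotation.\<close>

lemma out_arcs_same:
  assumes "v \<in> verts (graph \<Gamma>) - W"
  shows "out_arcs (graph \<Gamma>') v = out_arcs (graph \<Gamma>) v"
    and "h \<in> out_arcs (graph \<Gamma>) v \<Longrightarrow> h \<in> outer_half_edges \<Gamma> W s"
    and "h \<in> out_arcs (graph \<Gamma>) v \<Longrightarrow> rot \<Gamma>' h = rot \<Gamma> h"
proof -
  have v: "v \<notin> W" "v \<notin> W'"
    using assms same by (auto simp: same_outside_def)
  have spoke: "tail (graph \<Gamma>) h \<in> W" "tail (graph \<Gamma>') h \<in> W'" if "h \<in> range s" for h
    using that spokes by (auto simp: spokes_at_def)
  have eq: "tail (graph \<Gamma>') h = tail (graph \<Gamma>) h" "rot \<Gamma>' h = rot \<Gamma> h"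
    if "h \<in> outer_half_edges \<Gamma> W s" "h \<notin> range s" for h
    using that same by (simp_all add: same_outside_def)
  have 1: "h \<in> outer_half_edges \<Gamma> W s \<and> h \<notin> range s" if "h \<in> out_arcs (graph \<Gamma>) v" for h
    using that v spoke by (auto simp: outer_half_edges_def)
  have 2: "h \<in> outer_half_edges \<Gamma>' W' s \<and> h \<notin> range s" if "h \<in> out_arcs (graph \<Gamma>') v" for h
    using that v spoke by (auto simp: outer_half_edges_def)
  have arcs: "h \<in> arcs (graph \<Gamma>) \<and> h \<in> arcs (graph \<Gamma>')" if "h \<in> outer_half_edges \<Gamma> W s" for h
    using that outer_half_edges_same by (auto simp: outer_half_edges_def)
  show "out_arcs (graph \<Gamma>') v = out_arcs (graph \<Gamma>) v"
  proof (intro equalityI subsetI)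
    fix h assume h: "h \<in> out_arcs (graph \<Gamma>') v"
    with 2 have "h \<in> outer_half_edges \<Gamma> W s" "h \<notin> range s"
      unfolding outer_half_edges_same by blast+
    with h eq(1) arcs show "h \<in> out_arcs (graph \<Gamma>) v" by auto
  next
    fix h assume h: "h \<in> out_arcs (graph \<Gamma>) v"
    with 1 have "h \<in> outer_half_edges \<Gamma> W s" "h \<notin> range s" by blast+
    with h eq(1) arcs show "h \<in> out_arcs (graph \<Gamma>') v" by auto
  qed
  show "h \<in> outer_half_edges \<Gamma> W s" "rot \<Gamma>' h = rot \<Gamma> h" if "h \<in> out_arcs (graph \<Gamma>) v"
    using 1[OF that] eq(2) by blast+
qed

lemma outer_edges_same: "outer_edges \<Gamma>' W' s = outer_edges \<Gamma> W s"
  unfolding outer_edges_def outer_half_edges_same using edge_of_same by simp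

lemma outer_weight_same: "outer_weight \<Gamma>' W' s \<kappa> = outer_weight \<Gamma> W s \<kappa>"
proof -
  have "edge_sign \<Gamma>' e = edge_sign \<Gamma> e" if "e \<in> outer_edges \<Gamma> W s" for e
  proof -
    from that obtain h where "h \<in> outer_half_edges \<Gamma> W s" "e = edge_of \<Gamma> h"
      by (auto simp: outer_edges_def)
    then show ?thesis
      using same edge_of_same[of h] by (simp add: same_outside_def edge_sign_def)
  qed
  moreover have "node_sum \<Gamma>' \<kappa> v = node_sum \<Gamma> \<kappa> v" if "v \<in> verts (graph \<Gamma>) - W" for v
    unfolding node_sum_def out_arcs_same(1)[OF that]
  proof (intro sum.cong prod.cong refl)
    fix p h assume "h \<in> out_arcs (graph \<Gamma>) v"
    then show "hooft (\<kappa> (edge_of \<Gamma>' h)) (p (rot \<Gamma>' h)) (p h) =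
        hooft (\<kappa> (edge_of \<Gamma> h)) (p (rot \<Gamma> h)) (p h)"
      using out_arcs_same(2,3)[OF that] edge_of_same by simp
  qed
  moreover have "verts (graph \<Gamma>') - W' = verts (graph \<Gamma>) - W"
    using same by (simp add: same_outside_def)
  ultimately show ?thesis
    by (simp add: outer_weight_def outer_edges_same)
qed

lemma spoke_sum_same: "spoke_sum z \<Gamma>' W' s m = spoke_sum z \<Gamma> W s m"
proof -
  have "edge_of \<Gamma>' (s i) = edge_of \<Gamma> (s i)" for i
    using spokes by (intro edge_of_same) (auto simp: spokes_at_def outer_half_edges_def)
  then show ?thesis
    by (simp add: spoke_sum_def outer_edges_same outer_weight_same)
qed

lemma full_ribbon_graph_same:
  assumes "full_ribbon_graph \<Gamma>" "is_ribbon_graph \<Gamma>'"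
  shows "full_ribbon_graph \<Gamma>'"
proof
  fix v assume v: "v \<in> verts (graph \<Gamma>')"
  show "out_arcs (graph \<Gamma>') v \<noteq> {}"
  proof (cases "v \<in> W'")
    case True
    then show ?thesis using spokes(2) by (simp add: spokes_at_def)
  next
    case False
    then have "v \<in> verts (graph \<Gamma>) - W"
      using v same by (auto simp: same_outside_def)
    then show ?thesis
      using out_arcs_same(1) full_ribbon_graph.no_isolated[OF assms(1)] by simp
  qed
qed (fact assms(2))

end

text \<open>The bracket of the replaced graph becomes a sum over hue assignments of the original
  one, so that different replacements can be compared summand by summand.\<close>

lemma replaced_by_bracket:
  assumes "full_ribbon_graph \<Gamma>" "spokes_at \<Gamma> W s" "replaced_by \<Gamma> W s conf \<Gamma>'"
    and "\<And>W'. conf \<Gamma>' W' s \<Longrightarrow> spokes_at \<Gamma>' W' s"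
    and "\<And>W'. full_ribbon_graph \<Gamma>' \<Longrightarrow> conf \<Gamma>' W' s \<Longrightarrow>
      penrose_bracket \<Gamma>' 4 = spoke_sum z \<Gamma>' W' s m"
  shows "penrose_bracket \<Gamma>' 4 = spoke_sum z \<Gamma> W s m"
proof -
  from assms(3) obtain W' where "is_ribbon_graph \<Gamma>'" and conf: "conf \<Gamma>' W' s"
    and same: "same_outside s \<Gamma> W \<Gamma>' W'"
    by (auto simp: replaced_by_def)
  note 1 = same assms(2) assms(4)[OF conf]
  have "full_ribbon_graph \<Gamma>'"
    using full_ribbon_graph_same[OF 1 assms(1)] \<open>is_ribbon_graph \<Gamma>'\<close> .
  then show ?thesis
    using assms(5)[OF _ conf] spoke_sum_same[OF 1] by simp
qed

theorem theorem3p7: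
  fixes \<Gamma> \<Gamma>Q :: "('v, 'h) ribbon_graph"
    and \<Gamma>T :: "5 \<Rightarrow> ('v, 'h) ribbon_graph"
    and W :: "'v set"
    and s :: "5 \<Rightarrow> 'h"
  assumes "is_ribbon_graph \<Gamma>"
    and "connected (graph \<Gamma>)"
    and "trivalent \<Gamma>"
    and "pentagon_config \<Gamma> W s"
    and "inj (\<lambda>i. edge_of \<Gamma> (s i))"
    and "replaced_by \<Gamma> W s Q_config \<Gamma>Q"
    and "\<And>m. replaced_by \<Gamma> W s (T_config m) (\<Gamma>T m)"
  shows "penrose_bracket \<Gamma> 4 =
      3 / 2 * penrose_bracket \<Gamma>Q 4
      - 4 * penrose_bracket (\<Gamma>T 2) 4
      - penrose_bracket (\<Gamma>T 3) 4
      + 2 * penrose_bracket (\<Gamma>T 4) 4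
      + 2 * penrose_bracket (\<Gamma>T 5) 4
      - penrose_bracket (\<Gamma>T 1) 4"
proof -
  \<comment> \<open>A vertex of degree 3 has a half-edge.\<close>
  have full: "full_ribbon_graph \<Gamma>"
    using assms(1,3) by unfold_locales (auto simp: trivalent_def out_degree_def)
  note spokes = spokes_at_pentagon[OF assms(4)]
  have P: "penrose_bracket \<Gamma> 4 = spoke_sum pentagon_weight \<Gamma> W s 1"
    by (rule full_ribbon_graph.pentagon_bracket[OF full assms(4)])
  have Q: "penrose_bracket \<Gamma>Q 4 = spoke_sum quadrilateral_weight \<Gamma> W s 1"
    by (rule replaced_by_bracket[OF full spokes assms(6) spokes_at_quadrilateral
          full_ribbon_graph.quadrilateral_bracket])
  have T: "penrose_bracket (\<Gamma>T m) 4 = spoke_sum tree_weight \<Gamma> W s m" for m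
    by (rule replaced_by_bracket[OF full spokes assms(7) spokes_at_tree
          full_ribbon_graph.tree_bracket])
  \<comment> \<open>The tree with root \<open>m\<close> reads the spokes up to \<open>m + 4\<close>,
    which is at most 9; indices are modulo 5.\<close>
  have wrap: "s 6 = s 1" "s 7 = s 2" "s 8 = s 3" "s 9 = s 4"
    by (rule arg_cong[where f = s]; simp)+
  \<comment> \<open>All brackets are now sums over the same hue assignments with the same outer
    weight, so \<open>weight_identity\<close> applies to each summand.\<close>
  show ?thesis
    unfolding P Q T spoke_sum_def weight_identity
    by (simp add: wrap sum.distrib sum_subtractf sum_distrib_left algebra_simps)
qed

end
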